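(* Let $G$ be a group and let $Z$ be the upper hypercenter of $G$. Suppose that $G/Z$ is finite and put $|G/Z| = t$. Then $G$ has a finite normal subgroup $L$ such that $G/L$ is hypercentral and $|L|\leq t^k$, where $k = \frac{1}{2}(\log_p t+1)$ and $p$ is the least prime divisor of $t$ (when $t=1$, the bound $t^k$ is read as $1$).
   Context: The upper central series of a group $G$ is the ascending series $\langle 1\rangle=\zeta_0(G)\leq\zeta_1(G)\leq\cdots\leq\zeta_\alpha(G)\leq\zeta_{\alpha+1}(G)\leq\cdots\leq\zeta_\infty(G)$, where $\zeta_1(G)=\zeta(G)$ is the center of $G$, $\zeta_{\alpha+1}(G)/\zeta_\alpha(G)=\zeta(G/\zeta_\alpha(G))$ for all ordinals $\alpha$, and $\zeta_\lambda(G)=\bigcup_{\mu<\lambda}\zeta_\mu(G)$ for every limit ordinal $\lambda$. The series is continued transfinitely until it stabilizes. Its last term $\zeta_\infty(G)$ is called the upper hypercenter of $G$. The group $G$ is called hypercentral if $\zeta_\infty(G)=G$. The group $G$ is not assumed finite. *)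

theory Defs
  imports Complex_Main "HOL-Computational_Algebra.Primes" "HOL-Algebra.Algebra"
begin

definition center :: "('a, 'm) monoid_scheme \<Rightarrow> 'a set" where
  "center G = {z \<in> carrier G. \<forall>x \<in> carrier G. z \<otimes>\<^bsub>G\<^esub> x = x \<otimes>\<^bsub>G\<^esub> z}"

text \<open>
  For a normal subgroup \<open>H\<close>, \<open>next_center G H\<close> is the subgroup containing \<open>H\<close>
  whose image in \<open>G Mod H\<close> is the center of \<open>G Mod H\<close>
  (see \<open>next_center_quotient\<close> below).
\<close>

definition next_center :: "('a, 'm) monoid_scheme \<Rightarrow> 'a set \<Rightarrow> 'a set" where
  "next_center G H = {x \<in> carrier G. H #>\<^bsub>G\<^esub> x \<in> center (G Mod H)}"

definition pred_of :: "'i rel \<Rightarrow> 'i \<Rightarrow> 'i \<Rightarrow> bool" where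
  "pred_of r j i \<longleftrightarrow> j \<in> underS r i \<and> (\<forall>k \<in> underS r i. (k, j) \<in> r)"

text \<open>
  Ordinals are represented as the elements of a well-order \<open>r\<close>: \<open>upper_central G r i\<close> is
  \<open>\<zeta>\<^sub>\<alpha>(G)\<close>, where \<open>\<alpha>\<close> is the order type of the initial segment of \<open>r\<close> strictly below \<open>i\<close>.
\<close>

definition upper_central :: "('a, 'm) monoid_scheme \<Rightarrow> 'i rel \<Rightarrow> 'i \<Rightarrow> 'a set" where
  "upper_central G r = wo_rel.worec r (\<lambda>Z i.
     if underS r i = {} then {\<one>\<^bsub>G\<^esub>}
     else if \<exists>j. pred_of r j i then next_center G (Z (THE j. pred_of r j i))
     else (\<Union>j \<in> underS r i. Z j))"

text \<open>
  The index well-order \<open>|UNIV :: 'a set set|\<close> has more elements than \<open>'a\<close>, so the series is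
  stationary before it is exhausted; the union of its terms is therefore its last term, and no
  longer well-order yields a larger one (see \<open>upper_hypercenter_is_last_term\<close> below).
\<close>

definition upper_hypercenter :: "('a, 'm) monoid_scheme \<Rightarrow> 'a set" where
  "upper_hypercenter G = (\<Union>i. upper_central G |UNIV :: 'a set set| i)"

definition hypercentral :: "('a, 'm) monoid_scheme \<Rightarrow> bool" where
  "hypercentral G \<longleftrightarrow> upper_hypercenter G = carrier G"


subsection \<open>The series satisfies its defining equations\<close>

lemma upper_central_unfold:
  assumes "Well_order r"
  shows "upper_central G r i =
     (if underS r i = {} then {\<one>\<^bsub>G\<^esub>}
      else if \<exists>j. pred_of r j i then next_center G (upper_central G r (THE j. pred_of r j i))
      else (\<Union>j \<in> underS r i. upper_central G r j))"
proof -
  have W: "wo_rel r" using assms by (simp add: wo_rel_def)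
  have uniq: "(THE j. pred_of r j i) \<in> underS r i" if ex: "\<exists>j. pred_of r j i" for i
  proof -
    obtain j where j: "pred_of r j i" using ex by blast
    have "(THE j. pred_of r j i) = j"
      using j wo_rel.ANTISYM[OF W] by (intro the_equality) (auto simp: pred_of_def antisym_def)
    then show ?thesis using j by (simp add: pred_of_def)
  qed
  show ?thesis
    unfolding upper_central_def
    by (subst wo_rel.worec_fixpoint[OF W]) (auto simp: wo_rel.adm_wo_def[OF W] uniq)
qed

lemma upper_central_zero:
  "Well_order r \<Longrightarrow> underS r i = {} \<Longrightarrow> upper_central G r i = {\<one>\<^bsub>G\<^esub>}"
  by (simp add: upper_central_unfold)

lemma upper_central_succ:
  assumes "Well_order r" "pred_of r j i"
  shows "upper_central G r i = next_center G (upper_central G r j)"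
proof -
  have W: "wo_rel r" using assms by (simp add: wo_rel_def)
  have "(THE j. pred_of r j i) = j"
    using assms(2) wo_rel.ANTISYM[OF W] by (intro the_equality) (auto simp: pred_of_def antisym_def)
  moreover have "underS r i \<noteq> {}" using assms(2) by (auto simp: pred_of_def)
  ultimately show ?thesis using assms by (subst upper_central_unfold) auto
qed

lemma upper_central_limit:
  "Well_order r \<Longrightarrow> underS r i \<noteq> {} \<Longrightarrow> \<nexists>j. pred_of r j i \<Longrightarrow>
     upper_central G r i = (\<Union>j \<in> underS r i. upper_central G r j)"
  by (subst upper_central_unfold) auto

lemma next_center_iff_coset:
  fixes G (structure)
  assumes "H \<lhd> G"
  shows "x \<in> next_center G H \<longleftrightarrow>
    x \<in> carrier G \<and> (\<forall>y \<in> carrier G. H #> (x \<otimes> y) = H #> (y \<otimes> x))"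
proof -
  interpret normal H G by fact
  have "H #> x \<in> carrier (G Mod H)" if "x \<in> carrier G"
    using that by (auto simp: FactGroup_def RCOSETS_def)
  moreover have "(\<forall>Y \<in> carrier (G Mod H). P Y) \<longleftrightarrow> (\<forall>y \<in> carrier G. P (H #> y))" for P
    by (auto simp: FactGroup_def RCOSETS_def)
  ultimately show ?thesis
    by (auto simp: next_center_def center_def rcos_sum)
qed

lemma next_center_iff:
  fixes G (structure)
  assumes "H \<lhd> G"
  shows "x \<in> next_center G H \<longleftrightarrow>
    x \<in> carrier G \<and> (\<forall>y \<in> carrier G. (x \<otimes>\<^bsub>G\<^esub> y) \<otimes>\<^bsub>G\<^esub> inv\<^bsub>G\<^esub> (y \<otimes>\<^bsub>G\<^esub> x) \<in> H)"
proof -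
  interpret normal H G by fact
  have coset_eq: "H #> a = H #> b \<longleftrightarrow> a \<otimes> inv b \<in> H" if "a \<in> carrier G" "b \<in> carrier G" for a b
  proof
    assume "H #> a = H #> b"
    then have "H #> (a \<otimes> inv b) = H"
      using that coset_mult_inv2[of H a b] subset by simp
    then show "a \<otimes> inv b \<in> H"
      using that rcos_self[OF _ is_subgroup, of "a \<otimes> inv b"] by simp
  next
    assume "a \<otimes> inv b \<in> H"
    then have "H #> (a \<otimes> inv b) = H" using that coset_join2 is_subgroup by simp
    then show "H #> a = H #> b" using that coset_mult_inv1[of H a b] subset by simp
  qed
  show ?thesis
    unfolding next_center_iff_coset[OF assms] by (simp add: coset_eq cong: conj_cong)
qed

lemma next_center_quotient:
  assumes "H \<lhd> G"
  shows "(\<lambda>x. H #>\<^bsub>G\<^esub> x) ` next_center G H = center (G Mod H)"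
  by (auto simp: next_center_def center_def FactGroup_def RCOSETS_def)

lemma next_center_mono:
  fixes G (structure)
  assumes "H \<lhd> G" "K \<lhd> G" "H \<subseteq> K"
  shows "next_center G H \<subseteq> next_center G K"
  unfolding next_center_iff[OF assms(1)] next_center_iff[OF assms(2)] subset_iff
  using assms(3) by blast

lemma next_center_superset:
  fixes G (structure)
  assumes "H \<lhd> G"
  shows "H \<subseteq> next_center G H"
proof
  interpret normal H G by fact
  fix x assume x: "x \<in> H"
  have "(x \<otimes> y) \<otimes> inv (y \<otimes> x) \<in> H" if y: "y \<in> carrier G" for y
  proof -
    have "(x \<otimes> y) \<otimes> inv (y \<otimes> x) = x \<otimes> (y \<otimes> inv x \<otimes> inv y)"
      using x y by (simp add: inv_mult_group m_assoc)
    then show ?thesis using x y inv_op_closed2 by simp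
  qed
  then show "x \<in> next_center G H" using x by (auto simp: next_center_iff[OF assms])
qed

lemma next_center_normal:
  fixes G (structure)
  assumes "H \<lhd> G"
  shows "next_center G H \<lhd> G"
proof -
  interpret normal H G by fact
  interpret Q: group "G Mod H" by (rule factorgroup_is_group)
  note memb = next_center_iff_coset[OF assms]
  have swap: "H #> (a \<otimes> (x \<otimes> y) \<otimes> b) = H #> (a \<otimes> (y \<otimes> x) \<otimes> b)"
    if "x \<in> next_center G H" "y \<in> carrier G" "a \<in> carrier G" "b \<in> carrier G" for x y a b
  proof -
    have e: "H #> (a \<otimes> u \<otimes> b) = (H #> a) <#> (H #> u) <#> (H #> b)" if "u \<in> carrier G" for u
      using that \<open>a \<in> _\<close> \<open>b \<in> _\<close> by (simp add: rcos_sum)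
    have "x \<in> carrier G" "H #> (x \<otimes> y) = H #> (y \<otimes> x)" using that memb by auto
    then show ?thesis using e[of "x \<otimes> y"] e[of "y \<otimes> x"] that by simp
  qed
  show ?thesis
  proof (rule normal_invI)
    show "subgroup (next_center G H) G"
    proof (rule subgroupI)
      show "next_center G H \<subseteq> carrier G" using memb by blast
      show "next_center G H \<noteq> {}" using memb[of \<one>] by auto
    next
      fix x assume x: "x \<in> next_center G H"
      then have xc: "x \<in> carrier G" using memb by blast
      have "H #> (inv x \<otimes> y) = H #> (y \<otimes> inv x)" if y: "y \<in> carrier G" for y
      proof -
        have "inv x \<otimes> (x \<otimes> y) \<otimes> inv x = y \<otimes> inv x"
          using xc y by (simp flip: m_assoc)
        moreover have "inv x \<otimes> (y \<otimes> x) \<otimes> inv x = inv x \<otimes> y"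
          using xc y by (simp add: m_assoc)
        ultimately show ?thesis using swap[OF x y, of "inv x" "inv x"] xc by simp
      qed
      then show "inv x \<in> next_center G H" using memb xc by blast
    next
      fix x z assume x: "x \<in> next_center G H" and z: "z \<in> next_center G H"
      then have c: "x \<in> carrier G" "z \<in> carrier G" using memb by blast+
      have "H #> (x \<otimes> z \<otimes> y) = H #> (y \<otimes> (x \<otimes> z))" if y: "y \<in> carrier G" for y
        using swap[OF z y, of x \<one>] swap[OF x y, of \<one> z] c y by (simp add: m_assoc)
      then show "x \<otimes> z \<in> next_center G H" using memb c by blast
    qed
  next
    fix x h assume x: "x \<in> carrier G" and h: "h \<in> next_center G H"
    then have hc: "h \<in> carrier G" using memb by blast
    have conj: "H #> (a \<otimes> (x \<otimes> h \<otimes> inv x) \<otimes> b) = H #> (a \<otimes> h \<otimes> b)"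
      if "a \<in> carrier G" "b \<in> carrier G" for a b
    proof -
      have "x \<otimes> (inv x \<otimes> b) = b" using that x by (simp flip: m_assoc)
      then have "a \<otimes> (h \<otimes> x) \<otimes> (inv x \<otimes> b) = a \<otimes> h \<otimes> b"
        using that x hc by (simp add: m_assoc)
      moreover have "a \<otimes> (x \<otimes> h) \<otimes> (inv x \<otimes> b) = a \<otimes> (x \<otimes> h \<otimes> inv x) \<otimes> b"
        using that x hc by (simp add: m_assoc)
      ultimately show ?thesis using swap[OF h x, of a "inv x \<otimes> b"] that x by simp
    qed
    have "H #> (x \<otimes> h \<otimes> inv x \<otimes> y) = H #> (y \<otimes> (x \<otimes> h \<otimes> inv x))" if y: "y \<in> carrier G" for y
      using conj[of \<one> y] conj[of y \<one>] swap[OF h y, of \<one> \<one>] x y hc by simp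
    then show "x \<otimes> h \<otimes> inv x \<in> next_center G H" using memb x hc by blast
  qed
qed

lemma normal_UN_chain:
  fixes G (structure)
  assumes "group G" "I \<noteq> {}" "\<And>i. i \<in> I \<Longrightarrow> N i \<lhd> G"
    and chain: "\<And>i j. i \<in> I \<Longrightarrow> j \<in> I \<Longrightarrow> N i \<subseteq> N j \<or> N j \<subseteq> N i"
  shows "(\<Union>i \<in> I. N i) \<lhd> G"
proof -
  interpret group G by fact
  have sub: "subgroup (N i) G" if "i \<in> I" for i
    using assms(3) that normal_imp_subgroup by blast
  show ?thesis
  proof (rule normal_invI)
    show "subgroup (\<Union>i \<in> I. N i) G"
    proof (rule subgroupI)
      show "(\<Union>i \<in> I. N i) \<subseteq> carrier G" by (auto dest: subgroup.mem_carrier[OF sub])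
      show "(\<Union>i \<in> I. N i) \<noteq> {}" using assms(2) subgroup.one_closed[OF sub] by blast
    next
      fix a assume "a \<in> (\<Union>i \<in> I. N i)"
      then show "inv a \<in> (\<Union>i \<in> I. N i)" by (auto intro: subgroup.m_inv_closed[OF sub])
    next
      fix a b assume "a \<in> (\<Union>i \<in> I. N i)" "b \<in> (\<Union>i \<in> I. N i)"
      then obtain i j where ij: "i \<in> I" "j \<in> I" "a \<in> N i" "b \<in> N j" by blast
      then obtain k where "k \<in> I" "a \<in> N k" "b \<in> N k" using chain[of i j] by blast
      then show "a \<otimes> b \<in> (\<Union>i \<in> I. N i)" by (auto intro: subgroup.m_closed[OF sub])
    qed
  next
    fix x h assume "x \<in> carrier G" "h \<in> (\<Union>i \<in> I. N i)"
    then show "x \<otimes> h \<otimes> inv x \<in> (\<Union>i \<in> I. N i)"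
      by (auto intro: normal.inv_op_closed2[OF assms(3)])
  qed
qed

lemma upper_central_normal_aux:
  assumes "group G" and r: "Well_order r"
  shows "upper_central G r i \<lhd> G \<and>
    (\<forall>j \<in> underS r i. next_center G (upper_central G r j) \<subseteq> upper_central G r i)"
proof -
  have W: "wo_rel r" using r by (simp add: wo_rel_def)
  show ?thesis
  proof (induction i rule: wo_rel.well_order_induct[OF W])
    case (1 i)
    then have IH: "upper_central G r j \<lhd> G"
        "\<And>k. k \<in> underS r j \<Longrightarrow> next_center G (upper_central G r k) \<subseteq> upper_central G r j"
      if "j \<in> underS r i" for j
      using that by (auto simp: underS_def)
    have le: "upper_central G r k \<subseteq> upper_central G r j"
      if "j \<in> underS r i" "k \<in> underS r j" for j k
    proof -
      have "k \<in> underS r i" using that wo_rel.TRANS[OF W] wo_rel.ANTISYM[OF W]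
        by (auto simp: underS_def trans_def antisym_def)
      then show ?thesis using IH(1) IH(2)[OF that] next_center_superset by blast
    qed
    have lin: "k = j \<or> k \<in> underS r j \<or> j \<in> underS r k"
      if "j \<in> underS r i" "k \<in> underS r i" for j k
      using that wo_rel.TOTALS[OF W] by (auto simp: underS_def Field_def)
    show ?case
    proof (cases "underS r i = {}")
      case True
      then show ?thesis
        using upper_central_zero[OF r True, of G] group.one_is_normal[OF assms(1)] by simp
    next
      case ne: False
      show ?thesis
      proof (cases "\<exists>j. pred_of r j i")
        case True
        then obtain j where j: "pred_of r j i" by blast
        then have ji: "j \<in> underS r i" by (simp add: pred_of_def)
        have "next_center G (upper_central G r k) \<subseteq> next_center G (upper_central G r j)"
          if k: "k \<in> underS r i" for k
        proof (cases "k = j")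
          case False
          then have "k \<in> underS r j" using j k by (auto simp: pred_of_def underS_def)
          then show ?thesis using le[OF ji] IH(1) ji k next_center_mono by blast
        qed simp
        then show ?thesis
          using upper_central_succ[OF r j, of G] next_center_normal[OF IH(1)[OF ji]] by simp
      next
        case lim: False
        have "upper_central G r k \<subseteq> upper_central G r j \<or> upper_central G r j \<subseteq> upper_central G r k"
          if "j \<in> underS r i" "k \<in> underS r i" for j k
          using lin[OF that] le that by blast
        then have "(\<Union>j \<in> underS r i. upper_central G r j) \<lhd> G"
          using normal_UN_chain[OF assms(1) ne] IH(1) by blast
        moreover have "next_center G (upper_central G r j) \<subseteq> (\<Union>j \<in> underS r i. upper_central G r j)"
          if j: "j \<in> underS r i" for j
        proof -
          obtain k where k: "k \<in> underS r i" "(k, j) \<notin> r" using lim j by (auto simp: pred_of_def)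
          then have "j \<in> underS r k"
            using lin[OF j k(1)] wo_rel.REFL[OF W] j by (auto simp: underS_def refl_on_def Field_def)
          then show ?thesis using IH(2) k by blast
        qed
        ultimately show ?thesis using upper_central_limit[OF r ne lim, of G] by simp
      qed
    qed
  qed
qed

lemmas upper_central_normal = upper_central_normal_aux[THEN conjunct1]

lemma upper_central_next:
  "group G \<Longrightarrow> Well_order r \<Longrightarrow> j \<in> underS r i \<Longrightarrow>
     next_center G (upper_central G r j) \<subseteq> upper_central G r i"
  by (rule upper_central_normal_aux[THEN conjunct2, THEN bspec])

text \<open>The order \<open>s\<close> below ranges over well-orders of arbitrary types, hence of any length.\<close>

lemma upper_central_le_fixpoint:
  assumes "group G" and s: "Well_order s" and K: "K \<lhd> G" "next_center G K = K"
  shows "upper_central G s i \<subseteq> K"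
proof -
  have one: "\<one>\<^bsub>G\<^esub> \<in> K"
    using subgroup.one_closed[OF normal_imp_subgroup[OF K(1)]] .
  have W: "wo_rel s" using s by (simp add: wo_rel_def)
  show ?thesis
  proof (induction i rule: wo_rel.well_order_induct[OF W])
    case (1 i)
    then have IH: "upper_central G s j \<subseteq> K" if "j \<in> underS s i" for j
      using that by (auto simp: underS_def)
    consider "underS s i = {}" | j where "pred_of s j i"
      | "underS s i \<noteq> {}" "\<nexists>j. pred_of s j i" by blast
    then show ?case
    proof cases
      case 1
      then show ?thesis using upper_central_zero[OF s 1, of G] one by simp
    next
      case (2 j)
      then have "upper_central G s j \<subseteq> K" using IH by (simp add: pred_of_def)
      then have "next_center G (upper_central G s j) \<subseteq> K"
        using next_center_mono[OF upper_central_normal[OF assms(1) s] K(1)] K(2) by blast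
      then show ?thesis using upper_central_succ[OF s 2, of G] by simp
    next
      case 3
      then show ?thesis using upper_central_limit[OF s 3, of G] IH by auto
    qed
  qed
qed

theorem upper_hypercenter_is_last_term:
  fixes G :: "('a, 'm) monoid_scheme"
  assumes "group G"
  shows "\<exists>i. upper_hypercenter G = upper_central G |UNIV :: 'a set set| i"
    and "upper_hypercenter G \<lhd> G"
    and "next_center G (upper_hypercenter G) = upper_hypercenter G"
    and "\<And>s i. Well_order s \<Longrightarrow> upper_central G s i \<subseteq> upper_hypercenter G"
proof -
  define r where "r = |UNIV :: 'a set set|"
  have r: "Well_order r" by (simp add: r_def)
  have F: "Field r = UNIV" by (simp add: r_def)
  have W: "wo_rel r" using r by (simp add: wo_rel_def)
  have "\<exists>i. next_center G (upper_central G r i) = upper_central G r i"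
  proof (rule ccontr)
    assume "\<not> ?thesis"
    then have "\<exists>x. x \<in> next_center G (upper_central G r i) - upper_central G r i" for i
      using next_center_superset[OF upper_central_normal[OF assms r]] by blast
    then obtain e where e: "\<And>i. e i \<in> next_center G (upper_central G r i) - upper_central G r i"
      by metis
    have "e i \<noteq> e j" if "i \<in> underS r j" for i j
      using upper_central_next[OF assms r that] e[of i] e[of j] by auto
    moreover have "i = j \<or> i \<in> underS r j \<or> j \<in> underS r i" for i j
      using wo_rel.TOTALS[OF W] F by (auto simp: underS_def)
    ultimately have "inj e" by (metis injI)
    then show False
      using Cantors_theorem[of "UNIV :: 'a set"]
      by (metis Pow_UNIV inj_imp_surj_inv)
  qed
  then obtain i where i: "next_center G (upper_central G r i) = upper_central G r i" by blast
  have "upper_central G r j \<subseteq> upper_central G r i" for j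
    using upper_central_le_fixpoint[OF assms r upper_central_normal[OF assms r] i] .
  then have U: "upper_hypercenter G = upper_central G r i"
    by (auto simp: upper_hypercenter_def r_def)
  then show "\<exists>i. upper_hypercenter G = upper_central G |UNIV :: 'a set set| i"
    by (auto simp: r_def)
  show N: "upper_hypercenter G \<lhd> G" using U upper_central_normal[OF assms r] by simp
  show fp: "next_center G (upper_hypercenter G) = upper_hypercenter G" using U i by simp
  show "upper_central G s j \<subseteq> upper_hypercenter G" if "Well_order s" for s :: "'c rel" and j
    using upper_central_le_fixpoint[OF assms that N fp] .
qed

end

theory Submission
  imports Defs
begin

text \<open>
  Let \<open>Z\<close> be the upper hypercenter. Since \<open>G/Z\<close> is finite, \<open>G = Z U\<close> for a finitely generated subgroup
  \<open>U\<close>. In a finitely generated group the upper central series is exhausted after \<open>\<omega>\<close> steps, because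
  centrality modulo a stage can be tested on finitely many generators. As \<open>Z \<inter> U\<close> has finite index in
  \<open>U\<close>, finitely many of its elements, lying in one stage \<open>n\<close>, suffice to show that \<open>U\<close> is finite over its
  stage \<open>n\<close> (\<open>upper_hypercenter_finite_index_generators\<close>). This is the situation of Baer's theorem:
  Schur's argument, applied \<open>n\<close> times, makes the lower central series of \<open>U\<close> finite, so it becomes
  constant at a finite subgroup \<open>L = [L,U]\<close> (\<open>lower_central_finite_stable\<close>).

  The subgroup \<open>L\<close> commutes with every \<open>z\<close> in \<open>Z\<close>. Indeed \<open>U\<close> and \<open>z\<close> together still generate a finitely
  generated group, in which \<open>z\<close> lies in a finite stage of the upper central series while \<open>L\<close> lies in all
  terms of the lower one; such elements commute (\<open>lower_upper_commutator\<close>). Since \<open>G = Z U\<close>, it follows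
  that \<open>L\<close> is normal in \<open>G\<close>, and \<open>G/L\<close> is hypercentral because \<open>Z\<close> is hypercentrally embedded and \<open>U/L\<close>
  is nilpotent (\<open>finite_residual_exists\<close>).

  For the bound put \<open>K = L \<inter> Z\<close>. This is a central subgroup of \<open>L\<close>, and \<open>s = |L/K|\<close> divides \<open>t\<close>. The
  nilpotent group \<open>U/L\<close> acts on the abelian group \<open>L/L'\<close> with \<open>[L/L', U] = L/L'\<close>, and this leaves no
  nontrivial fixed points (\<open>trivial_fixed_points_of_perfect_section\<close>); hence \<open>K\<close> is contained in \<open>L'\<close>.
  Let \<open>P\<close> be a Sylow \<open>q\<close>-subgroup of \<open>L\<close> and \<open>q^n\<close> the \<open>q\<close>-part of \<open>s\<close>. By transfer, \<open>P \<inter> K\<close> is contained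
  in \<open>P'\<close>, and \<open>P'\<close> has order at most \<open>q^(n(n-1)/2)\<close> because the central subgroup \<open>P \<inter> K\<close> of \<open>P\<close> has
  index at most \<open>q^n\<close> (\<open>prime_power_order_derived_bound\<close>, \<open>multiplicity_central_derived_bound\<close>). So the
  \<open>q\<close>-part of \<open>|L| = s |K|\<close> is at most \<open>q^(n(n+1)/2) = (q^n)^((n+1)/2)\<close>. Here \<open>n \<le> log p t\<close>, and
  multiplying over all primes \<open>q\<close> gives \<open>|L| \<le> s^k \<le> t^k\<close>.
\<close>

section \<open>Commutators\<close>

text \<open>
  The convention is \<open>[x,y] = x y x^-1 y^-1\<close>, written as the quotient of \<open>x y\<close> by \<open>y x\<close> because
  this is the form in which \<open>next_center_iff\<close> expresses centrality modulo a subgroup.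
\<close>

definition commutator :: "('a, 'm) monoid_scheme \<Rightarrow> 'a \<Rightarrow> 'a \<Rightarrow> 'a" where
  "commutator G x y = (x \<otimes>\<^bsub>G\<^esub> y) \<otimes>\<^bsub>G\<^esub> inv\<^bsub>G\<^esub> (y \<otimes>\<^bsub>G\<^esub> x)"

context group
begin

lemma inv_mult_cancel:
  assumes "x \<in> carrier G" "y \<in> carrier G"
  shows "inv x \<otimes> (x \<otimes> y) = y" "x \<otimes> (inv x \<otimes> y) = y"
  using assms by (simp_all flip: m_assoc)

lemma commute_inv:
  assumes "x \<in> carrier G" "y \<in> carrier G" "x \<otimes> y = y \<otimes> x"
  shows "inv x \<otimes> y = y \<otimes> inv x"
proof -
  have "inv x \<otimes> y = inv x \<otimes> (y \<otimes> x \<otimes> inv x)"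
    using assms(1,2) by (simp add: m_assoc)
  also have "\<dots> = inv x \<otimes> (x \<otimes> y \<otimes> inv x)"
    by (simp only: assms(3))
  also have "\<dots> = y \<otimes> inv x"
    using assms(1,2) by (simp add: m_assoc inv_mult_cancel)
  finally show ?thesis .
qed

text \<open>
  These rules bring a word in group elements and their inverses into its right-nested freely reduced
  form, which is enough to prove every identity that holds in all groups.
\<close>

lemmas word_simps = m_assoc inv_mult_group inv_mult_cancel

lemma commutator_closed [simp]:
  "x \<in> carrier G \<Longrightarrow> y \<in> carrier G \<Longrightarrow> commutator G x y \<in> carrier G"
  by (simp add: commutator_def)

lemma commutator_eq_one_iff:
  assumes "x \<in> carrier G" "y \<in> carrier G"
  shows "commutator G x y = \<one> \<longleftrightarrow> x \<otimes> y = y \<otimes> x"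
  using assms inv_solve_right'[of \<one> "x \<otimes> y" "y \<otimes> x"]
  by (metis commutator_def inv_closed inv_mult_group l_one m_closed one_closed r_inv right_cancel)

lemma commutator_subgroup:
  assumes "subgroup U G" "x \<in> U" "y \<in> U"
  shows "commutator (G\<lparr>carrier := U\<rparr>) x y = commutator G x y"
  using assms by (simp add: commutator_def subgroup.m_closed)

lemma commutator_inv:
  assumes "x \<in> carrier G" "y \<in> carrier G"
  shows "inv (commutator G x y) = commutator G y x"
  using assms by (simp add: commutator_def word_simps)

lemma commutator_conj:
  assumes "x \<in> carrier G" "y \<in> carrier G" "g \<in> carrier G"
  shows "g \<otimes> commutator G x y \<otimes> inv g =
    commutator G (g \<otimes> x \<otimes> inv g) (g \<otimes> y \<otimes> inv g)"
  using assms by (simp add: commutator_def word_simps)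

lemma commutator_in_normal:
  assumes "N \<lhd> G" "x \<in> carrier G" "y \<in> carrier G" "x \<in> N \<or> y \<in> N"
  shows "commutator G x y \<in> N"
proof -
  interpret N: normal N G by fact
  have e: "commutator G x y = x \<otimes> (y \<otimes> inv x \<otimes> inv y)"
    "commutator G x y = (x \<otimes> y \<otimes> inv x) \<otimes> inv y"
    using assms by (simp_all add: commutator_def word_simps)
  show ?thesis
    using assms(4)
  proof
    assume "x \<in> N"
    then show ?thesis unfolding e(1) using assms(3) N.inv_op_closed2 by simp
  next
    assume "y \<in> N"
    then show ?thesis unfolding e(2) using assms(2) N.inv_op_closed2 by simp
  qed
qed

lemma next_center_commutator:
  assumes "H \<lhd> G"
  shows "x \<in> next_center G H \<longleftrightarrow>
    x \<in> carrier G \<and> (\<forall>y \<in> carrier G. commutator G x y \<in> H)"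
  using next_center_iff[OF assms] by (simp add: commutator_def)

lemma coset_eq_iff:
  assumes "subgroup H G" "x \<in> carrier G" "y \<in> carrier G"
  shows "H #> x = H #> y \<longleftrightarrow> x \<otimes> inv y \<in> H"
proof
  assume "H #> x = H #> y"
  then have "x \<in> H #> y" using rcos_self[OF assms(2,1)] by simp
  then show "x \<otimes> inv y \<in> H"
    using subgroup.rcos_module[OF assms(1) is_group assms(3,2)] by simp
next
  assume "x \<otimes> inv y \<in> H"
  then have "x \<in> H #> y"
    using subgroup.rcos_module[OF assms(1) is_group assms(3,2)] by simp
  then show "H #> x = H #> y" using repr_independence[OF _ assms(3,1)] by simp
qed

lemma commute_mod_iff:
  assumes "H \<lhd> G" "x \<in> carrier G" "y \<in> carrier G"
  shows "commutator G x y \<in> H \<longleftrightarrow>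
    (H #> x) \<otimes>\<^bsub>G Mod H\<^esub> (H #> y) = (H #> y) \<otimes>\<^bsub>G Mod H\<^esub> (H #> x)"
proof -
  interpret normal H G by fact
  show ?thesis
    using assms coset_eq_iff[OF subgroup_axioms, of "x \<otimes> y" "y \<otimes> x"]
    by (simp add: commutator_def rcos_sum)
qed

text \<open>
  Hence commuting with \<open>z\<close> modulo \<open>H\<close> needs to be checked on generators only.
\<close>

lemma centralizer_mod_subgroup:
  assumes "H \<lhd> G" "z \<in> carrier G"
  shows "subgroup {x \<in> carrier G. commutator G x z \<in> H} G"
proof -
  interpret H: normal H G by fact
  interpret Q: group "G Mod H" by (rule H.factorgroup_is_group)
  have cl: "H #> x \<in> carrier (G Mod H)" if "x \<in> carrier G" for x
    using that by (auto simp: carrier_FactGroup)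
  have hm: "H #> (x \<otimes> y) = (H #> x) \<otimes>\<^bsub>G Mod H\<^esub> (H #> y)" if "x \<in> carrier G" "y \<in> carrier G" for x y
    using that by (simp add: H.rcos_sum)
  have hi: "H #> (inv x) = inv\<^bsub>G Mod H\<^esub> (H #> x)" if "x \<in> carrier G" for x
    using that by (simp add: H.inv_FactGroup carrier_FactGroup H.rcos_inv)
  show ?thesis
  proof (rule subgroupI)
    show "{x \<in> carrier G. commutator G x z \<in> H} \<noteq> {}"
      using assms(2) by (auto intro!: exI[of _ \<one>] simp: commutator_def)
  next
    fix a assume a: "a \<in> {x \<in> carrier G. commutator G x z \<in> H}"
    have "inv\<^bsub>G Mod H\<^esub> (H #> a) \<otimes>\<^bsub>G Mod H\<^esub> (H #> z) = (H #> z) \<otimes>\<^bsub>G Mod H\<^esub> inv\<^bsub>G Mod H\<^esub> (H #> a)"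
      using Q.commute_inv[of "H #> a" "H #> z"] a cl assms commute_mod_iff[OF assms(1), of a z] by blast
    then show "inv a \<in> {x \<in> carrier G. commutator G x z \<in> H}"
      using a assms by (simp add: commute_mod_iff hi del: mult_FactGroup)
  next
    fix a b assume ab: "a \<in> {x \<in> carrier G. commutator G x z \<in> H}" "b \<in> {x \<in> carrier G. commutator G x z \<in> H}"
    then have c: "(H #> a) \<otimes>\<^bsub>G Mod H\<^esub> (H #> z) = (H #> z) \<otimes>\<^bsub>G Mod H\<^esub> (H #> a)"
       "(H #> b) \<otimes>\<^bsub>G Mod H\<^esub> (H #> z) = (H #> z) \<otimes>\<^bsub>G Mod H\<^esub> (H #> b)"
      using assms commute_mod_iff[OF assms(1) _ assms(2)] by blast+
    have "(H #> a) \<otimes>\<^bsub>G Mod H\<^esub> (H #> b) \<otimes>\<^bsub>G Mod H\<^esub> (H #> z) = (H #> z) \<otimes>\<^bsub>G Mod H\<^esub> ((H #> a) \<otimes>\<^bsub>G Mod H\<^esub> (H #> b))"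
      using ab assms cl c Q.m_assoc by (metis (no_types, lifting) mem_Collect_eq)
    then show "a \<otimes> b \<in> {x \<in> carrier G. commutator G x z \<in> H}"
      using ab assms by (simp add: commute_mod_iff hm del: mult_FactGroup)
  qed auto
qed

lemma commutator_swap_mem:
  assumes "subgroup H G" "x \<in> carrier G" "y \<in> carrier G" "commutator G x y \<in> H"
  shows "commutator G y x \<in> H"
  using commutator_inv[of x y] assms subgroup.m_inv_closed[OF assms(1,4)] by simp

section \<open>The hypercenter as a least closed set\<close>

text \<open>
  The hypercenter is generated by the rule "an element enters once all its commutators have entered":
  a successor stage applies the rule to the stage before, a limit stage takes a union. This replaces
  transfinite induction along the series by an induction that does not mention ordinals.
\<close>

lemma upper_hypercenter_least:
  assumes "\<one> \<in> S"
    and "\<And>x. x \<in> carrier G \<Longrightarrow> (\<And>y. y \<in> carrier G \<Longrightarrow> commutator G x y \<in> S) \<Longrightarrow> x \<in> S"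
  shows "upper_hypercenter G \<subseteq> S"
proof -
  define r where "r = |UNIV :: 'a set set|"
  have r: "Well_order r" by (simp add: r_def)
  have W: "wo_rel r" using r by (simp add: wo_rel_def)
  have "upper_central G r i \<subseteq> S" for i
  proof (induction i rule: wo_rel.well_order_induct[OF W])
    case (1 i)
    then have IH: "upper_central G r j \<subseteq> S" if "j \<in> underS r i" for j
      using that by (auto simp: underS_def)
    consider "underS r i = {}" | j where "pred_of r j i"
      | "underS r i \<noteq> {}" "\<nexists>j. pred_of r j i" by blast
    then show ?case
    proof cases
      case 1
      then show ?thesis using upper_central_zero[OF r 1, of G] assms(1) by simp
    next
      case (2 j)
      then have "upper_central G r j \<subseteq> S" using IH by (simp add: pred_of_def)
      then have "next_center G (upper_central G r j) \<subseteq> S"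
        using assms(2) next_center_commutator[OF upper_central_normal[OF is_group r]] by blast
      then show ?thesis using upper_central_succ[OF r 2, of G] by simp
    next
      case 3
      then show ?thesis using upper_central_limit[OF r 3, of G] IH by auto
    qed
  qed
  then show ?thesis by (auto simp: upper_hypercenter_def r_def)
qed

lemma upper_hypercenter_closed:
  assumes "x \<in> carrier G" "\<And>y. y \<in> carrier G \<Longrightarrow> commutator G x y \<in> upper_hypercenter G"
  shows "x \<in> upper_hypercenter G"
  using upper_hypercenter_is_last_term(2,3)[OF is_group] next_center_commutator assms by blast

end

section \<open>The finite stages of the central series\<close>

text \<open>
  The numbering starts with the whole group at \<open>0\<close>, so that \<open>lower_central G n\<close> is the term that is
  usually written \<open>\<gamma>_(n+1)\<close>.
\<close>

primrec lower_central :: "('a, 'm) monoid_scheme \<Rightarrow> nat \<Rightarrow> 'a set" where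
  "lower_central G 0 = carrier G"
| "lower_central G (Suc n) =
     generate G {commutator G a g | a g. a \<in> lower_central G n \<and> g \<in> carrier G}"

text \<open>
  The stages of the upper central series below \<open>\<omega>\<close>. A finitely generated group needs no others, and
  they can be handled by induction on natural numbers.
\<close>

primrec nat_upper_central :: "('a, 'm) monoid_scheme \<Rightarrow> nat \<Rightarrow> 'a set" where
  "nat_upper_central G 0 = {\<one>\<^bsub>G\<^esub>}"
| "nat_upper_central G (Suc n) = next_center G (nat_upper_central G n)"

context group
begin

lemma nat_upper_central_normal: "nat_upper_central G n \<lhd> G"
  by (induction n) (simp_all add: one_is_normal next_center_normal)

lemma nat_upper_central_Suc_iff:
  "x \<in> nat_upper_central G (Suc n) \<longleftrightarrow>
    x \<in> carrier G \<and> (\<forall>y \<in> carrier G. commutator G x y \<in> nat_upper_central G n)"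
  using next_center_commutator[OF nat_upper_central_normal] by simp

lemma nat_upper_central_mono: "m \<le> n \<Longrightarrow> nat_upper_central G m \<subseteq> nat_upper_central G n"
  by (rule lift_Suc_mono_le) (use next_center_superset[OF nat_upper_central_normal] in auto)

lemma nat_upper_central_carrier: "nat_upper_central G n \<subseteq> carrier G"
  using normal_imp_subgroup[OF nat_upper_central_normal] subgroup.subset by blast

lemma generate_commutators_normal:
  assumes "N \<lhd> G"
  shows "generate G {commutator G a g | a g. a \<in> N \<and> g \<in> carrier G} \<lhd> G"
proof -
  interpret N: normal N G by fact
  show ?thesis
  proof (rule normal_generateI)
    show "{commutator G a g | a g. a \<in> N \<and> g \<in> carrier G} \<subseteq> carrier G" by auto
  next
    fix h g assume h: "h \<in> {commutator G a g | a g. a \<in> N \<and> g \<in> carrier G}" and g: "g \<in> carrier G"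
    then obtain a b where ab: "h = commutator G a b" "a \<in> N" "b \<in> carrier G" by blast
    then have "g \<otimes> h \<otimes> inv g = commutator G (g \<otimes> a \<otimes> inv g) (g \<otimes> b \<otimes> inv g)"
      using g by (simp add: commutator_conj)
    moreover have "g \<otimes> a \<otimes> inv g \<in> N" using N.inv_op_closed2 g ab by simp
    ultimately show "g \<otimes> h \<otimes> inv g \<in> {commutator G a g | a g. a \<in> N \<and> g \<in> carrier G}"
      using g ab by (auto intro!: exI)
  qed
qed

lemma generate_commutators_subset:
  assumes "N \<lhd> G"
  shows "generate G {commutator G a g | a g. a \<in> N \<and> g \<in> carrier G} \<subseteq> N"
proof (rule generate_subgroup_incl)
  show "{commutator G a g |a g. a \<in> N \<and> g \<in> carrier G} \<subseteq> N"
    using commutator_in_normal[OF assms] subgroup.mem_carrier[OF normal_imp_subgroup[OF assms]] by blast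
qed (rule normal_imp_subgroup[OF assms])

lemma lower_central_normal: "lower_central G n \<lhd> G"
  by (induction n) (simp_all add: normal_self generate_commutators_normal)

lemma lower_central_antimono: "m \<le> n \<Longrightarrow> lower_central G n \<subseteq> lower_central G m"
  by (rule lift_Suc_antimono_le)
    (use generate_commutators_subset[OF lower_central_normal] in auto)

lemma lower_central_commutator:
  "a \<in> lower_central G n \<Longrightarrow> g \<in> carrier G \<Longrightarrow> commutator G a g \<in> lower_central G (Suc n)"
  by (auto intro!: generate.incl)

lemma lower_central_subset_Suc:
  assumes "subgroup M G" "\<And>a g. a \<in> lower_central G n \<Longrightarrow> g \<in> carrier G \<Longrightarrow> commutator G a g \<in> M"
  shows "lower_central G (Suc n) \<subseteq> M"
  unfolding lower_central.simps by (rule generate_subgroup_incl) (use assms in auto)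

lemma lower_central_carrier: "lower_central G n \<subseteq> carrier G"
  using normal_imp_subgroup[OF lower_central_normal] subgroup.subset by blast

lemma lower_central_subgroup_mono:
  assumes "subgroup U G" "subgroup V G" "U \<subseteq> V"
  shows "lower_central (G\<lparr>carrier := U\<rparr>) n \<subseteq> lower_central (G\<lparr>carrier := V\<rparr>) n"
proof (induction n)
  case 0
  then show ?case using assms by simp
next
  case (Suc n)
  interpret U: group "G\<lparr>carrier := U\<rparr>" by (rule subgroup_imp_group[OF assms(1)])
  interpret V: group "G\<lparr>carrier := V\<rparr>" by (rule subgroup_imp_group[OF assms(2)])
  let ?S = "\<lambda>U. {commutator G a g | a g. a \<in> lower_central (G\<lparr>carrier := U\<rparr>) n \<and> g \<in> U}"
  have cc: "lower_central (G\<lparr>carrier := U\<rparr>) n \<subseteq> U" "lower_central (G\<lparr>carrier := V\<rparr>) n \<subseteq> V"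
    using U.lower_central_carrier V.lower_central_carrier by simp_all
  have eq: "lower_central (G\<lparr>carrier := W\<rparr>) (Suc n) = generate G (?S W)"
    if W: "subgroup W G" and c: "lower_central (G\<lparr>carrier := W\<rparr>) n \<subseteq> W" for W
  proof -
    interpret W: group "G\<lparr>carrier := W\<rparr>" by (rule subgroup_imp_group[OF W])
    have "{commutator (G\<lparr>carrier := W\<rparr>) a g |a g. a \<in> lower_central (G\<lparr>carrier := W\<rparr>) n \<and> g \<in> W} = ?S W"
      using commutator_subgroup[OF W subsetD[OF c]] by (intro Collect_cong iff_exI) auto
    moreover have "?S W \<subseteq> W"
    proof
      fix h assume "h \<in> ?S W"
      then obtain a g where ag: "h = commutator G a g" "a \<in> W" "g \<in> W" using c by blast
      then have "h = commutator (G\<lparr>carrier := W\<rparr>) a g" using commutator_subgroup[OF W] by simp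
      then show "h \<in> W" using W.commutator_closed ag by simp
    qed
    ultimately show ?thesis
      using generate_consistent[OF _ W, of "?S W"] by simp
  qed
  show ?case
    unfolding eq[OF assms(1) cc(1)] eq[OF assms(2) cc(2)]
    by (rule mono_generate) (use Suc assms in blast)
qed

end

section \<open>Commutators between the two central series\<close>

lemma (in group_hom) hom_commutator:
  "x \<in> carrier G \<Longrightarrow> y \<in> carrier G \<Longrightarrow> h (commutator G x y) = commutator H (h x) (h y)"
  by (simp add: commutator_def)

lemma (in normal) coset_group_hom: "group_hom G (G Mod H) (\<lambda>x. H #> x)"
  by (intro group_hom.intro group_hom_axioms.intro is_group factorgroup_is_group r_coset_hom_Mod)

context group
begin

text \<open>
  Put \<open>w = [z,a]\<close> and \<open>v = [z,x]\<close>. Conjugation by \<open>z\<close> takes \<open>[a,x]\<close> to \<open>[w a, v x]\<close>. The central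
  \<open>w\<close> drops out of this commutator, and moving \<open>v\<close> across \<open>a\<close> gives \<open>v [a,x] v^-1 = [a,x]\<close>. This is
  the three subgroups lemma for single elements.
\<close>

lemma three_subgroups_element:
  assumes c: "a \<in> carrier G" "x \<in> carrier G" "z \<in> carrier G"
    and w: "\<And>y. y \<in> carrier G \<Longrightarrow> commutator G z a \<otimes> y = y \<otimes> commutator G z a"
    and va: "commutator G z x \<otimes> a = a \<otimes> commutator G z x"
    and vc: "commutator G z x \<otimes> commutator G a x = commutator G a x \<otimes> commutator G z x"
  shows "commutator G a x \<otimes> z = z \<otimes> commutator G a x"
proof -
  define w where "w = commutator G z a"
  define v where "v = commutator G z x"
  define d where "d = commutator G a x"
  have cl: "w \<in> carrier G" "v \<in> carrier G" "d \<in> carrier G" using c by (simp_all add: w_def v_def d_def)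
  have za: "z \<otimes> a \<otimes> inv z = w \<otimes> a" "z \<otimes> x \<otimes> inv z = v \<otimes> x"
    using c by (simp_all add: w_def v_def commutator_def word_simps)
  have "z \<otimes> d \<otimes> inv z = commutator G (w \<otimes> a) (v \<otimes> x)"
    using c za commutator_conj[of a x z] by (simp add: d_def)
  also have "\<dots> = w \<otimes> (commutator G a (v \<otimes> x) \<otimes> (v \<otimes> x) \<otimes> inv w \<otimes> inv (v \<otimes> x))"
    using c cl by (simp add: commutator_def word_simps)
  also have "(v \<otimes> x) \<otimes> inv w = inv w \<otimes> (v \<otimes> x)"
    using commute_inv[of w "v \<otimes> x"] w[of "v \<otimes> x"] c cl by (simp add: w_def)
  then have "commutator G a (v \<otimes> x) \<otimes> (v \<otimes> x) \<otimes> inv w \<otimes> inv (v \<otimes> x) = commutator G a (v \<otimes> x) \<otimes> inv w"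
    using c cl by (simp add: m_assoc)
  also have "w \<otimes> (commutator G a (v \<otimes> x) \<otimes> inv w) = commutator G a (v \<otimes> x)"
    using w[of "commutator G a (v \<otimes> x)"] c cl unfolding w_def[symmetric]
    by (simp flip: m_assoc) (simp add: m_assoc)
  also have "commutator G a (v \<otimes> x) = (a \<otimes> v) \<otimes> inv a \<otimes> (d \<otimes> inv v)"
    using c cl by (simp add: d_def commutator_def word_simps)
  also have "\<dots> = (v \<otimes> a) \<otimes> inv a \<otimes> (d \<otimes> inv v)"
    using va by (simp only: v_def)
  also have "\<dots> = v \<otimes> d \<otimes> inv v" using c cl by (simp add: m_assoc)
  also have "\<dots> = d \<otimes> v \<otimes> inv v" using vc by (simp only: v_def d_def)
  also have "\<dots> = d" using c cl by (simp add: m_assoc)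
  finally have "z \<otimes> d \<otimes> inv z \<otimes> z = d \<otimes> z" by simp
  then show ?thesis using c cl by (simp add: m_assoc d_def)
qed

lemma three_subgroups_element_mod:
  assumes N: "N \<lhd> G" and c: "a \<in> carrier G" "x \<in> carrier G" "z \<in> carrier G"
    and w: "\<And>y. y \<in> carrier G \<Longrightarrow> commutator G (commutator G z a) y \<in> N"
    and va: "commutator G (commutator G z x) a \<in> N"
    and vc: "commutator G (commutator G z x) (commutator G a x) \<in> N"
  shows "commutator G (commutator G a x) z \<in> N"
proof -
  interpret N: normal N G by fact
  interpret Q: group "G Mod N" by (rule N.factorgroup_is_group)
  interpret h: group_hom G "G Mod N" "\<lambda>x. N #> x" by (rule N.coset_group_hom)
  note [simp del] = mult_FactGroup
  note iff = commute_mod_iff[OF N]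
  have cm: "N #> commutator G u v = commutator (G Mod N) (N #> u) (N #> v)"
    if "u \<in> carrier G" "v \<in> carrier G" for u v
    using h.hom_commutator that by simp
  have "commutator (G Mod N) (N #> a) (N #> x) \<otimes>\<^bsub>G Mod N\<^esub> (N #> z) =
    (N #> z) \<otimes>\<^bsub>G Mod N\<^esub> commutator (G Mod N) (N #> a) (N #> x)"
  proof (rule Q.three_subgroups_element)
    fix y assume "y \<in> carrier (G Mod N)"
    then obtain y' where y': "y' \<in> carrier G" "y = N #> y'" by (auto simp: carrier_FactGroup)
    show "commutator (G Mod N) (N #> z) (N #> a) \<otimes>\<^bsub>G Mod N\<^esub> y = y \<otimes>\<^bsub>G Mod N\<^esub> commutator (G Mod N) (N #> z) (N #> a)"
      using iff[of "commutator G z a" y'] w[of y'] c y' by (simp add: cm)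
  qed (use iff[of "commutator G z x" a] iff[of "commutator G z x" "commutator G a x"] va vc c in
      \<open>simp_all add: cm h.hom_closed\<close>)
  then show ?thesis using iff[of "commutator G a x" z] c by (simp add: cm)
qed

lemma commutator_one [simp]:
  "x \<in> carrier G \<Longrightarrow> commutator G x \<one> = \<one>" "x \<in> carrier G \<Longrightarrow> commutator G \<one> x = \<one>"
  by (simp_all add: commutator_def)

text \<open>
  The classical inclusion of \<open>[\<gamma>_i, \<zeta>_k]\<close> in \<open>\<zeta>_(k-i)\<close>; the shift by one comes from numbering the lower
  series from \<open>0\<close>, and truncated subtraction gives the trivial group once \<open>k \<le> j + 1\<close>. The induction
  runs over \<open>j\<close> and, inside, over \<open>k\<close>: a generator of the next lower term is \<open>[a,x]\<close> with \<open>a\<close> in the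
  term \<open>j\<close>, and the three subgroups lemma for \<open>a, x, z\<close> requires \<open>[z,x]\<close>, which lies one stage lower
  than \<open>z\<close>, to commute with \<open>a\<close> and with \<open>[a,x]\<close> modulo the stage aimed at.
\<close>

lemma lower_upper_commutator:
  assumes "a \<in> lower_central G j" "z \<in> nat_upper_central G k"
  shows "commutator G a z \<in> nat_upper_central G (k - Suc j)"
  using assms
proof (induction j arbitrary: a z k)
  case 0
  then show ?case
  proof (cases k)
    case (Suc m)
    then show ?thesis using 0 nat_upper_central_Suc_iff[of z m]
        commutator_swap_mem[OF normal_imp_subgroup[OF nat_upper_central_normal]] by simp
  qed simp
next
  case (Suc j)
  note jIH = Suc.IH
  from Suc.prems show ?case
  proof (induction k arbitrary: a z)
    case 0
    then show ?case using subsetD[OF lower_central_carrier[of "Suc j"]] by simp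
  next
    case (Suc k)
    define M where "M = nat_upper_central G (Suc k - Suc (Suc j))"
    have M: "M \<lhd> G" "subgroup M G"
      unfolding M_def using nat_upper_central_normal normal_imp_subgroup by blast+
    have z: "z \<in> carrier G" "\<And>y. y \<in> carrier G \<Longrightarrow> commutator G z y \<in> nat_upper_central G k"
      using Suc.prems(2) nat_upper_central_Suc_iff by blast+
    have "lower_central G (Suc j) \<subseteq> {x \<in> carrier G. commutator G x z \<in> M}"
    proof (rule lower_central_subset_Suc[OF centralizer_mod_subgroup[OF M(1) z(1)]])
      fix a x assume a: "a \<in> lower_central G j" and x: "x \<in> carrier G"
      have ac: "a \<in> carrier G" using a lower_central_carrier by blast
      have "commutator G (commutator G a x) z \<in> M"
      proof (rule three_subgroups_element_mod[OF M(1) ac x z(1)])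
        fix y assume y: "y \<in> carrier G"
        have "commutator G z a \<in> nat_upper_central G (Suc k - Suc j)"
          using commutator_swap_mem[OF normal_imp_subgroup[OF nat_upper_central_normal] ac z(1) jIH[OF a Suc.prems(2)]] .
        then show "commutator G (commutator G z a) y \<in> M"
          using nat_upper_central_Suc_iff[of _ "Suc k - Suc (Suc j)"] y ac z(1)
          by (cases "Suc k - Suc j") (auto simp: M_def Suc_diff_Suc)
      next
        have "commutator G a (commutator G z x) \<in> M"
          using jIH[OF a z(2)[OF x]] by (simp add: M_def)
        then show "commutator G (commutator G z x) a \<in> M"
          using commutator_swap_mem[OF M(2) ac] z x by simp
      next
        have "commutator G (commutator G a x) (commutator G z x) \<in> nat_upper_central G (k - Suc (Suc j))"
          using Suc.IH[OF lower_central_commutator[OF a x] z(2)[OF x]] .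
        moreover have "k - Suc (Suc j) \<le> Suc k - Suc (Suc j)" by arith
        ultimately have "commutator G (commutator G a x) (commutator G z x) \<in> M"
          unfolding M_def using nat_upper_central_mono by blast
        then show "commutator G (commutator G z x) (commutator G a x) \<in> M"
          using commutator_swap_mem[OF M(2)] z ac x by simp
      qed
      then show "commutator G a x \<in> {x \<in> carrier G. commutator G x z \<in> M}" using ac x by simp
    qed
    then show ?case using Suc.prems(1) by (auto simp: M_def)
  qed
qed

section \<open>Finitely generated subgroups\<close>

text \<open>
  The cosets of \<open>N\<close> with representatives in \<open>T\<close> form a set that is stable under right multiplication
  by the generators and their inverses.
\<close>

lemma generate_subset_cosets:
  assumes N: "subgroup N G" and T: "T \<subseteq> carrier G" and S: "S \<subseteq> carrier G" and one: "\<one> \<in> N <#> T"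
    and step: "\<And>t s. t \<in> T \<Longrightarrow> s \<in> S \<Longrightarrow> t \<otimes> s \<in> N <#> T \<and> t \<otimes> inv s \<in> N <#> T"
  shows "generate G S \<subseteq> N <#> T"
proof
  interpret N: subgroup N G by fact
  have mult: "w \<otimes> s \<in> N <#> T" if w: "w \<in> N <#> T" and s: "s \<in> carrier G" "\<And>t. t \<in> T \<Longrightarrow> t \<otimes> s \<in> N <#> T" for w s
  proof -
    obtain n t where nt: "n \<in> N" "t \<in> T" "w = n \<otimes> t" using w by (auto simp: set_mult_def)
    obtain n' t' where nt': "n' \<in> N" "t' \<in> T" "t \<otimes> s = n' \<otimes> t'" using s(2)[OF nt(2)] by (auto simp: set_mult_def)
    have "w \<otimes> s = n \<otimes> (t \<otimes> s)" using nt T s by (simp add: m_assoc subsetD)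
    also have "\<dots> = (n \<otimes> n') \<otimes> t'" using nt nt' T by (simp add: m_assoc subsetD)
    finally show ?thesis using nt nt' by (auto simp: set_mult_def)
  qed
  have NT: "N <#> T \<subseteq> carrier G" using T N.subset by (auto simp: set_mult_def)
  have "w \<otimes> x \<in> N <#> T" if "x \<in> generate G S" "w \<in> N <#> T" for x w
    using that
  proof (induction arbitrary: w rule: generate.induct)
    case one
    then show ?case using NT by auto
  next
    case (incl h)
    then show ?case using mult step S by blast
  next
    case (inv h)
    then show ?case using mult[of w "inv h"] step S by blast
  next
    case (eng h1 h2)
    have "h1 \<in> carrier G" "h2 \<in> carrier G" using eng.hyps generate_in_carrier[OF S] by auto
    then have "w \<otimes> (h1 \<otimes> h2) = (w \<otimes> h1) \<otimes> h2" using eng.prems NT by (simp add: m_assoc subsetD)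
    then show ?case using eng by simp
  qed
  then show "x \<in> N <#> T" if "x \<in> generate G S" for x
    using that one generate_in_carrier[OF S] by fastforce
qed

text \<open>
  If the commutators of \<open>x\<close> with the finitely many generators all lie in stages below \<open>\<omega>\<close>, then they
  lie in one common stage \<open>n\<close>. So \<open>x\<close> commutes with the generators, and hence with the whole subgroup,
  modulo stage \<open>n\<close>, and belongs to stage \<open>n + 1\<close>: the union of the finite stages is already closed.
\<close>

lemma upper_hypercenter_Int_generate:
  assumes S: "finite S" "S \<subseteq> carrier G"
  shows "upper_hypercenter G \<inter> generate G S \<subseteq>
    (\<Union>n. nat_upper_central (G\<lparr>carrier := generate G S\<rparr>) n)"
proof -
  define U where "U = generate G S"
  have U: "subgroup U G" unfolding U_def by (rule generate_is_subgroup[OF S(2)])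
  interpret U: group "G\<lparr>carrier := U\<rparr>" by (rule subgroup_imp_group[OF U])
  let ?Z = "nat_upper_central (G\<lparr>carrier := U\<rparr>)"
  have SU: "S \<subseteq> U" unfolding U_def using generate.incl by fast
  have "upper_hypercenter G \<subseteq> {x \<in> carrier G. x \<in> U \<longrightarrow> x \<in> (\<Union>n. ?Z n)}"
  proof (rule upper_hypercenter_least)
    show "\<one> \<in> {x \<in> carrier G. x \<in> U \<longrightarrow> x \<in> (\<Union>n. ?Z n)}"
      by (auto intro!: exI[of _ 0])
  next
    fix x assume x: "x \<in> carrier G"
      and IH: "\<And>y. y \<in> carrier G \<Longrightarrow> commutator G x y \<in> {x \<in> carrier G. x \<in> U \<longrightarrow> x \<in> (\<Union>n. ?Z n)}"
    have "x \<in> (\<Union>n. ?Z n)" if xU: "x \<in> U"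
    proof -
      have "\<exists>n. commutator G x s \<in> ?Z n" if "s \<in> S" for s
        using IH[of s] that S(2) SU xU U.commutator_closed commutator_subgroup[OF U] by fastforce
      then obtain f where f: "\<And>s. s \<in> S \<Longrightarrow> commutator G x s \<in> ?Z (f s)" by metis
      define n where "n = Max (insert 0 (f ` S))"
      have n: "commutator G x s \<in> ?Z n" if "s \<in> S" for s
      proof -
        have "f s \<le> n" unfolding n_def by (rule Max_ge) (use S(1) that in auto)
        then show ?thesis using U.nat_upper_central_mono f[OF that] by blast
      qed
      define C where "C = {y \<in> U. commutator G y x \<in> ?Z n}"
      have "subgroup C (G\<lparr>carrier := U\<rparr>)"
        using U.centralizer_mod_subgroup[OF U.nat_upper_central_normal, of x n] xU commutator_subgroup[OF U]
        by (simp add: C_def cong: conj_cong)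
      then have C: "subgroup C G" using incl_subgroup[OF U] by blast
      have "S \<subseteq> C"
      proof
        fix s assume s: "s \<in> S"
        have "commutator G s x \<in> ?Z n"
          using U.commutator_swap_mem[OF normal_imp_subgroup[OF U.nat_upper_central_normal], of x s n] n[OF s]
            s SU xU commutator_subgroup[OF U] by fastforce
        then show "s \<in> C" using s SU by (auto simp: C_def)
      qed
      then have UC: "U \<subseteq> C" unfolding U_def using generate_subgroup_incl[OF _ C] by blast
      have "x \<in> ?Z (Suc n)"
        unfolding U.nat_upper_central_Suc_iff
      proof (intro conjI ballI)
        fix y assume "y \<in> carrier (G\<lparr>carrier := U\<rparr>)"
        then have y: "y \<in> U" "commutator G y x \<in> ?Z n" using UC by (auto simp: C_def)
        then show "commutator (G\<lparr>carrier := U\<rparr>) x y \<in> ?Z n"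
          using U.commutator_swap_mem[OF normal_imp_subgroup[OF U.nat_upper_central_normal], of y x n] xU
            commutator_subgroup[OF U] by simp
      qed (use xU in simp)
      then show ?thesis by blast
    qed
    then show "x \<in> {x \<in> carrier G. x \<in> U \<longrightarrow> x \<in> (\<Union>n. ?Z n)}" using x by blast
  qed
  then show ?thesis unfolding U_def by blast
qed

text \<open>
  A weak form of Schreier's lemma. Choose representatives \<open>T'\<close> inside the subgroup \<open>generate G S\<close>. To
  write words in \<open>S\<close> as a product of an element of \<open>A\<close> and a representative, one only ever has to rewrite
  \<open>1\<close> and the finitely many products \<open>t s\<close> and \<open>t s^-1\<close>; \<open>E\<close> consists of the factors from \<open>A\<close> that
  occur there.
\<close>

lemma generate_finite_coset_cover:
  assumes S: "finite S" "S \<subseteq> carrier G" and A: "subgroup A G"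
    and T: "finite T" "T \<subseteq> carrier G" "generate G S \<subseteq> A <#> T"
  obtains E T' where "finite E" "E \<subseteq> A \<inter> generate G S" "finite T'" "T' \<subseteq> generate G S"
    "generate G S \<subseteq> generate G E <#> T'"
proof -
  define U where "U = generate G S"
  have U: "subgroup U G" unfolding U_def by (rule generate_is_subgroup[OF S(2)])
  interpret U: subgroup U G by fact
  interpret A: subgroup A G by fact
  have SU: "S \<subseteq> U" unfolding U_def using generate.incl by fast
  define T' where "T' = (\<lambda>t. SOME u. u \<in> U \<inter> (A #> t)) ` {t \<in> T. U \<inter> (A #> t) \<noteq> {}}"
  have "(SOME u. u \<in> U \<inter> (A #> t)) \<in> U" if "U \<inter> (A #> t) \<noteq> {}" for t
    using some_in_eq[of "U \<inter> (A #> t)"] that by blast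
  then have T': "finite T'" "T' \<subseteq> U" using T(1) unfolding T'_def by auto
  have "\<exists>a. a \<in> A \<inter> U \<and> (\<exists>t \<in> T'. u = a \<otimes> t)" if u: "u \<in> U" for u
  proof -
    obtain a t where at: "a \<in> A" "t \<in> T" "u = a \<otimes> t"
      using u T(3) by (auto simp: U_def set_mult_def)
    then have "u \<in> U \<inter> (A #> t)" using u by (auto simp: r_coset_def)
    define t' where "t' = (SOME u. u \<in> U \<inter> (A #> t))"
    have "t' \<in> U \<inter> (A #> t)" unfolding t'_def using \<open>u \<in> U \<inter> (A #> t)\<close> by (rule someI)
    then obtain a' where a': "a' \<in> A" "t' = a' \<otimes> t" "t' \<in> U" by (auto simp: r_coset_def)
    have "t' \<in> T'" using \<open>u \<in> U \<inter> (A #> t)\<close> at(2) by (auto simp: T'_def t'_def)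
    moreover have "a \<otimes> inv a' = u \<otimes> inv t'" using at a' T(2) by (simp add: word_simps subsetD)
    then have "a \<otimes> inv a' \<in> A \<inter> U" using at a' u by (metis A.m_closed A.m_inv_closed U.m_closed U.m_inv_closed IntI)
    moreover have "u = (a \<otimes> inv a') \<otimes> t'" using at a' T(2) by (simp add: word_simps subsetD)
    ultimately show ?thesis by blast
  qed
  then obtain f where f: "\<And>u. u \<in> U \<Longrightarrow> f u \<in> A \<inter> U" "\<And>u. u \<in> U \<Longrightarrow> \<exists>t \<in> T'. u = f u \<otimes> t" by metis
  define W where "W = insert \<one> ((\<lambda>(t, s). t \<otimes> s) ` (T' \<times> S) \<union> (\<lambda>(t, s). t \<otimes> inv s) ` (T' \<times> S))"
  have "finite W" using T' S(1) unfolding W_def by simp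
  moreover have "W \<subseteq> U" using T'(2) SU unfolding W_def by auto
  ultimately have W: "finite W" "W \<subseteq> U" by blast+
  have in_cover: "w \<in> generate G (f ` W) <#> T'" if "w \<in> W" for w
  proof -
    have "f w \<in> generate G (f ` W)" using that by (auto intro: generate.incl)
    then show ?thesis using f(2)[of w] that W by (auto simp: set_mult_def)
  qed
  have fW: "f ` W \<subseteq> A \<inter> U" using f(1) W by blast
  have "U \<subseteq> generate G (f ` W) <#> T'"
    unfolding U_def
  proof (rule generate_subset_cosets)
    show "subgroup (generate G (f ` W)) G" using fW U.subset by (intro generate_is_subgroup) blast
    show "T' \<subseteq> carrier G" using T' U.subset by blast
    show "\<one> \<in> generate G (f ` W) <#> T'" by (rule in_cover) (simp add: W_def)
    show "t \<otimes> s \<in> generate G (f ` W) <#> T' \<and> t \<otimes> inv s \<in> generate G (f ` W) <#> T'"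
      if "t \<in> T'" "s \<in> S" for t s
      using that by (intro conjI in_cover) (force simp: W_def)+
  qed (rule S(2))
  then show thesis using that[of "f ` W" T'] fW W T' unfolding U_def by blast
qed

lemma finite_coset_representatives:
  assumes "subgroup H G" "finite (rcosets H)"
  obtains T where "finite T" "T \<subseteq> carrier G" "carrier G \<subseteq> H <#> T"
proof -
  interpret H: subgroup H G by fact
  define f where "f = (\<lambda>c. SOME x. x \<in> carrier G \<and> c = H #> x)"
  have f: "f c \<in> carrier G \<and> c = H #> f c" if "c \<in> rcosets H" for c
    unfolding f_def by (rule someI_ex) (use that in \<open>auto simp: RCOSETS_def\<close>)
  have "x \<in> H <#> f ` (rcosets H)" if x: "x \<in> carrier G" for x
  proof -
    have c: "H #> x \<in> rcosets H" using rcosetsI[OF H.subset x] .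
    have "x \<in> H #> f (H #> x)" using rcos_self[OF x assms(1)] f[OF c] by metis
    then show ?thesis using c by (auto simp: set_mult_def r_coset_def)
  qed
  then show thesis using that[of "f ` (rcosets H)"] assms(2) f by blast
qed

text \<open>
  Take for \<open>S\<close> a transversal of the hypercenter \<open>Z\<close>. The finitely many elements of \<open>Z\<close> that Schreier's
  argument needs for \<open>S\<close> lie in a common finite stage \<open>n\<close> of the subgroup generated by \<open>S\<close>.
\<close>

lemma upper_hypercenter_finite_index_generators:
  assumes "finite (carrier (G Mod upper_hypercenter G))"
  obtains S n T where "finite S" "S \<subseteq> carrier G"
    "carrier G \<subseteq> upper_hypercenter G <#> generate G S"
    "finite T" "T \<subseteq> generate G S"
    "generate G S \<subseteq> nat_upper_central (G\<lparr>carrier := generate G S\<rparr>) n <#> T"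
proof -
  define Z where "Z = upper_hypercenter G"
  have Z: "subgroup Z G"
    unfolding Z_def using upper_hypercenter_is_last_term(2)[OF is_group] normal_imp_subgroup by blast
  have "finite (rcosets Z)" using assms by (simp add: Z_def FactGroup_def)
  then obtain S where S: "finite S" "S \<subseteq> carrier G" "carrier G \<subseteq> Z <#> S"
    using finite_coset_representatives[OF Z] by metis
  define U where "U = generate G S"
  have U: "subgroup U G" unfolding U_def by (rule generate_is_subgroup[OF S(2)])
  interpret U: group "G\<lparr>carrier := U\<rparr>" by (rule subgroup_imp_group[OF U])
  let ?Z = "nat_upper_central (G\<lparr>carrier := U\<rparr>)"
  have "generate G S \<subseteq> Z <#> S" using S(3) generate_in_carrier[OF S(2)] by blast
  from generate_finite_coset_cover[OF S(1,2) Z S(1,2) this]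
  obtain E T where E: "finite E" "E \<subseteq> Z \<inter> U" and T: "finite T" "T \<subseteq> U" "U \<subseteq> generate G E <#> T"
    unfolding U_def by metis
  have "\<exists>n. x \<in> ?Z n" if "x \<in> E" for x
    using upper_hypercenter_Int_generate[OF S(1,2)] E that unfolding Z_def U_def by fast
  then obtain f where f: "\<And>x. x \<in> E \<Longrightarrow> x \<in> ?Z (f x)" by metis
  define n where "n = Max (insert 0 (f ` E))"
  have "x \<in> ?Z n" if "x \<in> E" for x
  proof -
    have "f x \<le> n" unfolding n_def by (rule Max_ge) (use E(1) that in auto)
    then show ?thesis using U.nat_upper_central_mono f[OF that] by blast
  qed
  moreover have "subgroup (?Z n) G"
    using incl_subgroup[OF U normal_imp_subgroup[OF U.nat_upper_central_normal]] .
  ultimately have "generate G E \<subseteq> ?Z n" using generate_subgroup_incl by blast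
  then have "U \<subseteq> ?Z n <#> T" using T(3) mono_set_mult[of "generate G E" "?Z n" T T G] by blast
  moreover have "carrier G \<subseteq> Z <#> U"
    using S(3) mono_set_mult[of Z Z S U G] generate.incl[of _ S G] unfolding U_def by blast
  ultimately show thesis using that[of S T n] S T unfolding U_def Z_def by blast
qed

end

lemma (in comm_group) finite_generate_torsion:
  assumes "finite E" "E \<subseteq> carrier G" "\<And>x. x \<in> E \<Longrightarrow> \<exists>m>0. x [^] (m::nat) = \<one>"
  shows "finite (generate G E)"
  using assms
proof (induction E rule: finite_induct)
  case empty
  then show ?case by (simp add: generate_empty)
next
  case (insert x E)
  have x: "x \<in> carrier G" and E: "E \<subseteq> carrier G" using insert.prems by auto
  obtain m :: nat where m: "m > 0" "x [^] m = \<one>" using insert.prems(2) by blast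
  have "generate G {x} \<subseteq> (\<lambda>k. x [^] (k::int)) ` {0..<int m}"
  proof
    fix y assume "y \<in> generate G {x}"
    then obtain k :: int where k: "y = x [^] k" using generate_pow[OF x] by auto
    have xm: "x [^] int m = \<one>" using m by (simp add: int_pow_int)
    have "x [^] k = x [^] (int m * (k div int m) + k mod int m)" by simp
    also have "\<dots> = (x [^] int m) [^] (k div int m) \<otimes> x [^] (k mod int m)"
      using x by (simp only: int_pow_mult int_pow_pow)
    also have "\<dots> = x [^] (k mod int m)" using xm x by simp
    finally show "y \<in> (\<lambda>k. x [^] (k::int)) ` {0..<int m}" using k m by auto
  qed
  then have fx: "finite (generate G {x})" using finite_surj by blast
  have fE: "finite (generate G E)" using insert.IH E insert.prems by blast
  have sx: "subgroup (generate G {x}) G" and sE: "subgroup (generate G E) G"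
    using x E by (auto intro: generate_is_subgroup)
  have "generate G (insert x E) \<subseteq> generate G {x} <#> generate G E"
  proof (rule generate_subgroup_incl[OF _ mult_subgroups[OF sx sE]])
    have "x = x \<otimes> \<one>" "\<one> \<in> generate G E" "x \<in> generate G {x}"
      using x by (auto intro: generate.intros)
    then have "x \<in> generate G {x} <#> generate G E" unfolding set_mult_def by blast
    moreover have "y \<in> generate G {x} <#> generate G E" if "y \<in> E" for y
    proof -
      have "y = \<one> \<otimes> y" "\<one> \<in> generate G {x}" "y \<in> generate G E"
        using that E by (auto intro: generate.intros)
      then show ?thesis unfolding set_mult_def by blast
    qed
    ultimately show "insert x E \<subseteq> generate G {x} <#> generate G E" by blast
  qed
  moreover have "finite (generate G {x} <#> generate G E)"
    using fx fE by (simp add: set_mult_def)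
  ultimately show ?case using finite_subset by blast
qed

section \<open>The transfer\<close>

text \<open>
  The transfer. For a choice \<open>r\<close> of coset representatives, \<open>V g\<close> is the product of the elements
  \<open>\<phi> (r c \<cdot> g \<cdot> (r (c g))^-1)\<close> over all cosets \<open>c\<close>. It is multiplicative because \<open>g\<close> permutes the cosets
  and \<open>T\<close> is abelian. A central element \<open>z\<close> of \<open>H\<close> fixes every coset and contributes \<open>\<phi> z\<close> for each.
\<close>

lemma (in group) transfer_hom:
  assumes T: "comm_group T" and H: "subgroup H G" and fin: "finite (rcosets H)"
    and phi: "\<phi> \<in> hom (G\<lparr>carrier := H\<rparr>) T"
  obtains V where "V \<in> hom G T"
    "\<And>z. z \<in> H \<Longrightarrow> (\<And>g. g \<in> carrier G \<Longrightarrow> z \<otimes> g = g \<otimes> z) \<Longrightarrow> V z = \<phi> z [^]\<^bsub>T\<^esub> card (rcosets H)"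
proof -
  interpret T: comm_group T by fact
  interpret H: subgroup H G by fact
  define r where "r = (\<lambda>c. SOME x. x \<in> carrier G \<and> c = H #> x)"
  have r: "r c \<in> carrier G" "H #> r c = c" if "c \<in> rcosets H" for c
  proof -
    have "r c \<in> carrier G \<and> c = H #> r c"
      unfolding r_def by (rule someI_ex) (use that in \<open>auto simp: RCOSETS_def\<close>)
    then show "r c \<in> carrier G" "H #> r c = c" by simp_all
  qed
  have act: "c #> g \<in> rcosets H" if "c \<in> rcosets H" "g \<in> carrier G" for c g
    using that r[OF that(1)] coset_mult_assoc[OF H.subset, of "r c" g] rcosetsI[OF H.subset, of "r c \<otimes> g"] by simp
  have act_mult: "c #> (g \<otimes> g') = c #> g #> g'"
    if "c \<in> rcosets H" "g \<in> carrier G" "g' \<in> carrier G" for c g g'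
    using coset_mult_assoc[of c g g'] H.rcosets_carrier[OF is_group that(1)] that by auto
  define h where "h = (\<lambda>g c. r c \<otimes> g \<otimes> inv (r (c #> g)))"
  have h: "h g c \<in> H" if "c \<in> rcosets H" "g \<in> carrier G" for c g
  proof -
    have "H #> (r c \<otimes> g) = c #> g"
      using r that coset_mult_assoc[OF H.subset, of "r c" g] by simp
    then have "H #> (r c \<otimes> g) = H #> r (c #> g)" by (simp only: r(2)[OF act[OF that]])
    moreover have "r c \<otimes> g \<in> carrier G" using r(1) that by simp
    ultimately show ?thesis
      using coset_eq_iff[OF H _ r(1)[OF act[OF that]], of "r c \<otimes> g"] unfolding h_def by blast
  qed
  have h_mult: "h (g \<otimes> g') c = h g c \<otimes> h g' (c #> g)"
    if "c \<in> rcosets H" "g \<in> carrier G" "g' \<in> carrier G" for c g g'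
    using that r act by (simp add: h_def act_mult word_simps)
  have phic: "\<phi> x \<in> carrier T" if "x \<in> H" for x using hom_in_carrier[OF phi] that by simp
  have phim: "\<phi> (x \<otimes> y) = \<phi> x \<otimes>\<^bsub>T\<^esub> \<phi> y" if "x \<in> H" "y \<in> H" for x y
    using hom_mult[OF phi] that by simp
  define V where "V = (\<lambda>g. finprod T (\<lambda>c. \<phi> (h g c)) (rcosets H))"
  have Vc: "V g \<in> carrier T" if "g \<in> carrier G" for g
    unfolding V_def using phic h that by (intro T.finprod_closed) auto
  have "V (g \<otimes> g') = V g \<otimes>\<^bsub>T\<^esub> V g'" if g: "g \<in> carrier G" "g' \<in> carrier G" for g g'
  proof -
    have inj: "inj_on (\<lambda>c. c #> g) (rcosets H)"
    proof (rule inj_on_inverseI)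
      fix c assume c: "c \<in> rcosets H"
      then show "c #> g #> inv g = c"
        using act_mult[OF c g(1), of "inv g"] H.rcosets_carrier[OF is_group c] g by simp
    qed
    have img: "(\<lambda>c. c #> g) ` (rcosets H) = rcosets H"
      by (rule endo_inj_surj[OF fin _ inj]) (use act g in auto)
    have "V (g \<otimes> g') = finprod T (\<lambda>c. \<phi> (h g c) \<otimes>\<^bsub>T\<^esub> \<phi> (h g' (c #> g))) (rcosets H)"
      unfolding V_def using g phic phim h act by (intro T.finprod_cong') (auto simp: h_mult)
    also have "\<dots> = V g \<otimes>\<^bsub>T\<^esub> finprod T (\<lambda>c. \<phi> (h g' (c #> g))) (rcosets H)"
      unfolding V_def using g phic h act by (intro T.finprod_multf) auto
    also have "finprod T (\<lambda>c. \<phi> (h g' (c #> g))) (rcosets H) =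
        finprod T (\<lambda>c. \<phi> (h g' c)) ((\<lambda>c. c #> g) ` (rcosets H))"
      by (rule T.finprod_reindex[symmetric, OF _ inj]) (use img g phic h in auto)
    also have "\<dots> = V g'" unfolding img V_def ..
    finally show ?thesis .
  qed
  then have "V \<in> hom G T" using Vc by (intro homI)
  moreover have "V z = \<phi> z [^]\<^bsub>T\<^esub> card (rcosets H)"
    if z: "z \<in> H" and com: "\<And>g. g \<in> carrier G \<Longrightarrow> z \<otimes> g = g \<otimes> z" for z
  proof -
    have "h z c = z" if c: "c \<in> rcosets H" for c
    proof -
      have "c #> z = H #> (r c \<otimes> z)" using coset_mult_assoc[OF H.subset, of "r c" z] r[OF c] z by simp
      also have "\<dots> = H #> (z \<otimes> r c)" using com r[OF c] by simp
      also have "\<dots> = H #> z #> r c" using coset_mult_assoc[OF H.subset, of z "r c"] r[OF c] z by simp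
      also have "\<dots> = c" using H.rcos_const[OF is_group z] r[OF c] by simp
      finally have "h z c = z \<otimes> r c \<otimes> inv (r c)" using com r[OF c] by (simp add: h_def)
      then show ?thesis using r[OF c] z by (simp add: m_assoc)
    qed
    then have "V z = finprod T (\<lambda>c. \<phi> z) (rcosets H)"
      unfolding V_def using phic z by (intro T.finprod_cong') auto
    then show ?thesis using T.finprod_const[of "\<phi> z"] phic z by simp
  qed
  ultimately show thesis by (rule that)
qed

context group
begin

section \<open>Finiteness of commutator subgroups\<close>

lemma finite_rcosets_of_cover:
  assumes "subgroup H G" "finite T" "T \<subseteq> carrier G" "carrier G \<subseteq> H <#> T"
  shows "finite (rcosets H)"
proof -
  have "rcosets H \<subseteq> (\<lambda>t. H #> t) ` T"
  proof
    fix c assume "c \<in> rcosets H"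
    then obtain x where x: "x \<in> carrier G" "c = H #> x" by (auto simp: RCOSETS_def)
    then obtain a t where at: "a \<in> H" "t \<in> T" "x = a \<otimes> t" using assms(4) by (auto simp: set_mult_def)
    then have "x \<otimes> inv t = a" using assms subgroup.mem_carrier[OF assms(1)] by (simp add: m_assoc subsetD)
    then show "c \<in> (\<lambda>t. H #> t) ` T"
      using coset_eq_iff[OF assms(1) x(1), of t] at x assms(3) by auto
  qed
  then show ?thesis using assms(2) finite_surj by blast
qed

lemma pow_index_mem:
  assumes "H \<lhd> G" "finite (rcosets H)" "x \<in> carrier G"
  shows "x [^] card (rcosets H) \<in> H"
proof -
  interpret H: normal H G by fact
  interpret Q: group "G Mod H" by (rule H.factorgroup_is_group)
  interpret h: group_hom G "G Mod H" "\<lambda>x. H #> x" by (rule H.coset_group_hom)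
  have "H #> (x [^] card (rcosets H)) = (H #> x) [^]\<^bsub>G Mod H\<^esub> order (G Mod H)"
    using h.hom_nat_pow[OF assms(3)] by (simp add: order_def FactGroup_def)
  also have "\<dots> = H"
    using Q.pow_order_eq_1[of "H #> x"] h.hom_closed assms(3) by simp
  finally show ?thesis using coset_join1[OF _ _ H.is_subgroup] assms(3) by simp
qed

lemma center_subgroup: "subgroup (center G) G"
proof (rule subgroupI)
  show "center G \<noteq> {}" by (auto simp: center_def)
  show "inv a \<in> center G" if "a \<in> center G" for a
    using that commute_inv by (auto simp: center_def)
  show "a \<otimes> b \<in> center G" if "a \<in> center G" "b \<in> center G" for a b
  proof -
    have ab: "a \<in> carrier G" "b \<in> carrier G" "\<And>x. x \<in> carrier G \<Longrightarrow> a \<otimes> x = x \<otimes> a"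
      "\<And>x. x \<in> carrier G \<Longrightarrow> b \<otimes> x = x \<otimes> b"
      using that by (simp_all add: center_def)
    have "a \<otimes> b \<otimes> x = x \<otimes> (a \<otimes> b)" if x: "x \<in> carrier G" for x
    proof -
      have "a \<otimes> b \<otimes> x = a \<otimes> (b \<otimes> x)" using ab(1,2) x by (rule m_assoc)
      also have "\<dots> = a \<otimes> (x \<otimes> b)" by (simp only: ab(4)[OF x])
      also have "\<dots> = a \<otimes> x \<otimes> b" using ab(1,2) x by (simp only: m_assoc)
      also have "\<dots> = x \<otimes> a \<otimes> b" by (simp only: ab(3)[OF x])
      also have "\<dots> = x \<otimes> (a \<otimes> b)" using x ab(1,2) by (rule m_assoc)
      finally show ?thesis .
    qed
    then show ?thesis using ab(1,2) by (simp add: center_def)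
  qed
qed (auto simp: center_def)

text \<open>
  For \<open>N = G\<close> this is Schur's theorem that a group which is finite over its center has a finite derived
  subgroup. The commutator \<open>[a,g]\<close> does not change when \<open>a\<close> is multiplied by a central element or \<open>g\<close>
  by an element centralizing \<open>N\<close>, so \<open>[N,G]\<close> is generated by finitely many commutators. It is therefore
  finite over a finitely generated subgroup of \<open>K = N \<inter> center G\<close>, and it remains to bound the
  exponent of \<open>[N,G] \<inter> K\<close>.

  Let \<open>e\<close> be the index of \<open>K\<close> in \<open>N\<close> and let \<open>V\<close> be the transfer from \<open>N\<close> to \<open>K\<close>. Since \<open>a^e\<close> is central,
  it is the \<open>e\<close>-th power of every conjugate of \<open>a\<close>; thus \<open>V(a)^e = V(a^e)\<close> is not changed by conjugating
  \<open>a\<close>, and \<open>V([a,g])^e = 1\<close>. As \<open>V\<close> is the \<open>e\<close>-th power map on \<open>K\<close>, the exponent divides \<open>e^2\<close>.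
\<close>

lemma finite_commutator_subgroup:
  assumes N: "N \<lhd> G"
    and T: "finite T" "T \<subseteq> N" "N \<subseteq> (N \<inter> center G) <#> T"
    and R: "finite R" "R \<subseteq> carrier G" "carrier G \<subseteq> {c \<in> carrier G. \<forall>a \<in> N. c \<otimes> a = a \<otimes> c} <#> R"
  shows "finite (generate G {commutator G a g | a g. a \<in> N \<and> g \<in> carrier G})"
proof -
  interpret N: normal N G by fact
  define K where "K = N \<inter> center G"
  define S where "S = {commutator G a g | a g. a \<in> N \<and> g \<in> carrier G}"
  define D where "D = generate G S"
  have Sc: "S \<subseteq> carrier G" unfolding S_def by auto
  have DN: "D \<subseteq> N" unfolding D_def S_def by (rule generate_commutators_subset[OF N])
  have D: "subgroup D G" unfolding D_def by (rule generate_is_subgroup[OF Sc])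
  have Kcom: "k \<otimes> g = g \<otimes> k" if "k \<in> K" "g \<in> carrier G" for k g
    using that by (auto simp: K_def center_def)
  have K: "subgroup K G" unfolding K_def using subgroups_Inter_pair[OF N.subgroup_axioms center_subgroup] .
  interpret K: subgroup K G by fact
  have KN: "K \<subseteq> N" by (simp add: K_def)
  have Tc: "T \<subseteq> carrier G" using T(2) N.subset by blast
  have "S \<subseteq> (\<lambda>(a, g). commutator G a g) ` (T \<times> R)"
  proof
    fix s assume "s \<in> S"
    then obtain a g where ag: "a \<in> N" "g \<in> carrier G" "s = commutator G a g" by (auto simp: S_def)
    obtain k t where k: "k \<in> K" "t \<in> T" "a = k \<otimes> t" using T(3) ag(1) by (auto simp: set_mult_def K_def)
    obtain c u where c: "c \<in> carrier G" "\<forall>a \<in> N. c \<otimes> a = a \<otimes> c" "u \<in> R" "g = c \<otimes> u"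
      using R(3) ag(2) by (auto simp: set_mult_def)
    have cl: "k \<in> carrier G" "t \<in> carrier G" "u \<in> carrier G" using k c Tc R(2) by auto
    \<comment> \<open>The central factor \<open>k\<close> cancels first, then the factor \<open>c\<close>, which commutes with \<open>t\<close> and \<open>[t,u]\<close>.\<close>
    have "s = k \<otimes> (t \<otimes> g \<otimes> inv t) \<otimes> inv k \<otimes> inv g"
      using cl ag(2) by (simp add: ag(3) k commutator_def word_simps)
    also have "\<dots> = (t \<otimes> g \<otimes> inv t) \<otimes> k \<otimes> inv k \<otimes> inv g" using Kcom[OF k(1)] cl ag(2) by simp
    also have "\<dots> = (t \<otimes> c) \<otimes> u \<otimes> inv t \<otimes> inv u \<otimes> inv c"
      using cl c(1) by (simp add: word_simps c(4))
    also have "t \<otimes> c = c \<otimes> t" using c(2) k(2) T(2) by (metis subsetD)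
    also have "c \<otimes> t \<otimes> u \<otimes> inv t \<otimes> inv u \<otimes> inv c = c \<otimes> commutator G t u \<otimes> inv c"
      using cl c(1) by (simp add: word_simps commutator_def)
    also have "\<dots> = commutator G t u \<otimes> c \<otimes> inv c"
      using c(2) commutator_in_normal[OF N cl(2,3)] k(2) T(2) by (metis subsetD)
    finally have "s = commutator G t u" using cl c(1) by (simp add: m_assoc)
    then show "s \<in> (\<lambda>(a, g). commutator G a g) ` (T \<times> R)" using k(2) c(3) by auto
  qed
  then have finS: "finite S" by (rule finite_subset) (use T(1) R(1) in simp)

  interpret GN: group "G\<lparr>carrier := N\<rparr>" by (rule subgroup_imp_group[OF N.subgroup_axioms])
  have KsN: "subgroup K (G\<lparr>carrier := N\<rparr>)" using subgroup_incl[OF K N.subgroup_axioms KN] .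
  have KnN: "K \<lhd> G\<lparr>carrier := N\<rparr>"
  proof (rule GN.normal_invI[OF KsN])
    fix x h assume xh: "x \<in> carrier (G\<lparr>carrier := N\<rparr>)" "h \<in> K"
    have "x \<otimes> h \<otimes> inv x = h \<otimes> x \<otimes> inv x" using Kcom[of h x] xh by simp
    then have "x \<otimes> h \<otimes> inv x = h" using xh by (simp add: m_assoc)
    then show "x \<otimes>\<^bsub>G\<lparr>carrier := N\<rparr>\<^esub> h \<otimes>\<^bsub>G\<lparr>carrier := N\<rparr>\<^esub> inv\<^bsub>G\<lparr>carrier := N\<rparr>\<^esub> x \<in> K"
      using xh m_inv_consistent[OF N.subgroup_axioms] by simp
  qed
  interpret GK: comm_group "G\<lparr>carrier := K\<rparr>"
    by (rule group.group_comm_groupI[OF subgroup_imp_group[OF K]]) (use Kcom in auto)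
  define e where "e = card (rcosets\<^bsub>G\<lparr>carrier := N\<rparr>\<^esub> K)"
  have fr: "finite (rcosets\<^bsub>G\<lparr>carrier := N\<rparr>\<^esub> K)"
    by (rule GN.finite_rcosets_of_cover[OF KsN T(1)]) (use T in \<open>auto simp: K_def\<close>)
  have e: "e > 0" unfolding e_def using fr GN.rcosetsI[of K "\<one>"] KN by (auto simp: card_gt_0_iff)
  have "id \<in> hom (G\<lparr>carrier := N, carrier := K\<rparr>) (G\<lparr>carrier := K\<rparr>)" by (auto simp: hom_def)
  then have phi: "id \<in> hom (G\<lparr>carrier := N\<rparr>\<lparr>carrier := K\<rparr>) (G\<lparr>carrier := K\<rparr>)" by simp
  have "\<exists>V. V \<in> hom (G\<lparr>carrier := N\<rparr>) (G\<lparr>carrier := K\<rparr>) \<and> (\<forall>z \<in> K. V z = z [^] e)"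
  proof (rule GN.transfer_hom[OF GK.comm_group_axioms KsN fr phi])
    fix V assume V: "V \<in> hom (G\<lparr>carrier := N\<rparr>) (G\<lparr>carrier := K\<rparr>)"
      "\<And>z. z \<in> K \<Longrightarrow> (\<And>g. g \<in> carrier (G\<lparr>carrier := N\<rparr>) \<Longrightarrow>
        z \<otimes>\<^bsub>G\<lparr>carrier := N\<rparr>\<^esub> g = g \<otimes>\<^bsub>G\<lparr>carrier := N\<rparr>\<^esub> z) \<Longrightarrow>
        V z = id z [^]\<^bsub>G\<lparr>carrier := K\<rparr>\<^esub> card (rcosets\<^bsub>G\<lparr>carrier := N\<rparr>\<^esub> K)"
    have "V z = z [^] e" if "z \<in> K" for z
      using V(2)[OF that] Kcom[OF that] by (simp add: e_def nat_pow_consistent[symmetric])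
    then show ?thesis using V(1) by blast
  qed
  then obtain V where V: "V \<in> hom (G\<lparr>carrier := N\<rparr>) (G\<lparr>carrier := K\<rparr>)" "\<And>z. z \<in> K \<Longrightarrow> V z = z [^] e"
    by blast
  have Vc: "V a \<in> K" "V a \<in> carrier G" if "a \<in> N" for a
    using hom_in_carrier[OF V(1)] that K.subset by auto
  have Vm: "V (a \<otimes> b) = V a \<otimes> V b" if "a \<in> N" "b \<in> N" for a b
    using hom_mult[OF V(1)] that by simp
  have V1: "V \<one> = \<one>" using V(2)[of \<one>] by simp
  have Npow: "a [^] (n::nat) \<in> N" if "a \<in> N" for a n
    using that by (induction n) auto
  have Vpow: "V (a [^] (n::nat)) = V a [^] n" if "a \<in> N" for a n
    by (induction n) (simp_all add: V1 Vm Npow that)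
  have epow: "a [^] e \<in> K" if "a \<in> N" for a
    using GN.pow_index_mem[OF KnN fr, of a] that by (simp add: e_def nat_pow_consistent[symmetric])
  \<comment> \<open>The kernel of the \<open>e\<close>-th power of the transfer. It contains all \<open>[a,g]\<close>, which are products of
    \<open>a\<close> and a conjugate \<open>b\<close> of its inverse.\<close>
  define D' where "D' = {w \<in> N. V w [^] e = \<one>}"
  have D': "subgroup D' G"
  proof (rule subgroupI)
    show "D' \<subseteq> carrier G" "D' \<noteq> {}" using V1 by (auto simp: D'_def intro!: exI[of _ \<one>])
    show "a \<otimes> b \<in> D'" if "a \<in> D'" "b \<in> D'" for a b
      using that Vc Vm pow_mult_distrib[of "V a" "V b" e] Kcom[of "V a" "V b"] by (auto simp: D'_def)
    show "inv a \<in> D'" if "a \<in> D'" for a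
    proof -
      have a: "a \<in> N" "inv a \<in> N" "V a [^] e = \<one>" using that by (auto simp: D'_def)
      have "\<one> = V (a \<otimes> inv a) [^] e" using a V1 by simp
      also have "\<dots> = V a [^] e \<otimes> V (inv a) [^] e"
        using Vm[OF a(1,2)] pow_mult_distrib[of "V a" "V (inv a)" e] Kcom[of "V a" "V (inv a)"] Vc a by simp
      finally show ?thesis using a Vc[OF a(2)] by (simp add: D'_def)
    qed
  qed
  have "S \<subseteq> D'"
  proof
    fix s assume "s \<in> S"
    then obtain a g where ag: "a \<in> N" "g \<in> carrier G" "s = commutator G a g" by (auto simp: S_def)
    define b where "b = g \<otimes> inv a \<otimes> inv g"
    have b: "b \<in> N" using N.inv_op_closed2[OF ag(2), of "inv a"] ag(1) by (simp add: b_def)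
    have s: "s = a \<otimes> b" using ag by (simp add: b_def commutator_def word_simps)
    have conj: "b [^] n = g \<otimes> (inv a) [^] n \<otimes> inv g" for n :: nat
    proof (induction n)
      case (Suc n)
      have "b [^] Suc n = g \<otimes> (inv a) [^] n \<otimes> inv g \<otimes> (g \<otimes> inv a \<otimes> inv g)"
        using Suc by (simp add: b_def)
      then show ?case using ag by (simp add: word_simps)
    qed (use ag in simp)
    have "b [^] e = (inv a) [^] e"
    proof -
      have "b [^] e = (inv a) [^] e \<otimes> g \<otimes> inv g"
        using conj[of e] Kcom[OF epow, of "inv a" g] ag by simp
      then show ?thesis using ag by (simp add: m_assoc)
    qed
    then have be: "b [^] e = inv (a [^] e)" using nat_pow_inv[of a e] ag by simp
    have "V s [^] e = V a [^] e \<otimes> V b [^] e"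
      using Vm[OF ag(1) b] pow_mult_distrib[of "V a" "V b" e] Kcom[of "V a" "V b"] Vc ag b s by simp
    also have "\<dots> = V (a [^] e \<otimes> b [^] e)" using Vm Vpow Npow ag b by simp
    also have "\<dots> = \<one>" using V1 be ag by simp
    finally show "s \<in> D'" using s ag b by (simp add: D'_def)
  qed
  then have DD': "D \<subseteq> D'" unfolding D_def using generate_subgroup_incl[OF _ D'] by blast
  have tors: "w [^] (e * e) = \<one>" if "w \<in> K \<inter> D" for w
    using that DD' V(2)[of w] nat_pow_pow[of w e e] by (auto simp: D'_def)
  have "generate G S \<subseteq> K <#> T" using DN T(3) by (auto simp: D_def K_def)
  from generate_finite_coset_cover[OF finS Sc K T(1) Tc this]
  obtain E T' where E: "finite E" "E \<subseteq> K \<inter> D" and T': "finite T'" "D \<subseteq> generate G E <#> T'"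
    unfolding D_def by metis
  have EK: "E \<subseteq> K" using E by blast
  have "finite (generate (G\<lparr>carrier := K\<rparr>) E)"
  proof (rule GK.finite_generate_torsion[OF E(1)])
    show "\<exists>m>0. x [^]\<^bsub>G\<lparr>carrier := K\<rparr>\<^esub> (m::nat) = \<one>\<^bsub>G\<lparr>carrier := K\<rparr>\<^esub>" if "x \<in> E" for x
      using tors[of x] that E e by (intro exI[of _ "e * e"]) (auto simp: nat_pow_consistent[symmetric])
  qed (use EK in simp)
  then have "finite (generate G E)" using generate_consistent[OF EK K] by simp
  then have "finite (generate G E <#> T')" using T'(1) by (simp add: set_mult_def)
  then show ?thesis using finite_subset[OF T'(2)] unfolding D_def S_def by blast
qed

section \<open>A finite stable term of the lower central series\<close>

lemma cover_by_representatives: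
  assumes M: "subgroup M G" and A: "A \<subseteq> carrier G" and fin: "finite ((\<lambda>x. M #> x) ` A)"
  obtains T where "finite T" "T \<subseteq> A" "A \<subseteq> M <#> T"
proof -
  obtain T where T: "T \<subseteq> A" "finite T" "(\<lambda>x. M #> x) ` A = (\<lambda>x. M #> x) ` T"
    using finite_subset_image[OF fin, of "\<lambda>x. M #> x" A] by blast
  have "x \<in> M <#> T" if x: "x \<in> A" for x
  proof -
    obtain t where t: "t \<in> T" "M #> x = M #> t" using T(3) x by blast
    then have "x \<in> M #> t" using rcos_self[OF _ M, of x] x A by auto
    then show ?thesis using t(1) by (auto simp: r_coset_def set_mult_def)
  qed
  then show thesis using that[OF T(2,1)] by blast
qed

text \<open>
  Baer's theorem as a descent: every term \<open>i\<close> of the lower series is finite over stage \<open>n - i\<close> of the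
  upper series. Modulo stage \<open>n - i - 1\<close>, the image of stage \<open>n - i\<close> is central, and the image of stage
  \<open>n\<close> centralizes that of term \<open>i\<close> by \<open>lower_upper_commutator\<close>. So \<open>finite_commutator_subgroup\<close> applies
  in this quotient, where the commutator subgroup is the image of term \<open>i + 1\<close>.
\<close>

lemma lower_central_cover:
  assumes T: "finite T" "T \<subseteq> carrier G" "carrier G \<subseteq> nat_upper_central G n <#> T"
  shows "i \<le> n \<Longrightarrow> \<exists>T'. finite T' \<and> T' \<subseteq> lower_central G i \<and>
    lower_central G i \<subseteq> nat_upper_central G (n - i) <#> T'"
proof (induction i)
  case 0
  then show ?case using T by auto
next
  case (Suc i)
  then obtain R where R: "finite R" "R \<subseteq> lower_central G i"
    "lower_central G i \<subseteq> nat_upper_central G (n - i) <#> R" by auto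
  define M where "M = nat_upper_central G (n - Suc i)"
  have ni: "n - i = Suc (n - Suc i)" using Suc.prems by simp
  have M: "M \<lhd> G" unfolding M_def by (rule nat_upper_central_normal)
  interpret M: normal M G by (rule M)
  interpret Q: group "G Mod M" by (rule M.factorgroup_is_group)
  interpret q: group_hom G "G Mod M" "\<lambda>x. M #> x" by (rule M.coset_group_hom)
  note [simp del] = mult_FactGroup
  let ?q = "\<lambda>x. M #> x"
  note com = commute_mod_iff[OF M]
  define N where "N = ?q ` lower_central G i"
  have li: "lower_central G i \<subseteq> carrier G" by (rule lower_central_carrier)
  have qsurj: "carrier (G Mod M) = ?q ` carrier G" by (rule carrier_FactGroup)
  have N: "N \<lhd> G Mod M"
    unfolding N_def
    by (rule normal.surj_hom_normal_subgroup[OF lower_central_normal q.group_hom_axioms])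
      (simp add: qsurj)
  have fin: "finite (generate (G Mod M) {commutator (G Mod M) a g | a g. a \<in> N \<and> g \<in> carrier (G Mod M)})"
  proof (rule Q.finite_commutator_subgroup[OF N])
    show "finite (?q ` R)" "?q ` R \<subseteq> N" using R by (auto simp: N_def)
    show "N \<subseteq> (N \<inter> center (G Mod M)) <#>\<^bsub>G Mod M\<^esub> (?q ` R)"
    proof
      fix c assume "c \<in> N"
      then obtain x where x: "x \<in> lower_central G i" "c = ?q x" by (auto simp: N_def)
      then obtain z t where zt: "z \<in> nat_upper_central G (n - i)" "t \<in> R" "x = z \<otimes> t"
        using R(3) by (auto simp: set_mult_def)
      have cl: "z \<in> carrier G" "t \<in> carrier G"
        using zt R(2) li nat_upper_central_carrier by blast+
      have "z = x \<otimes> inv t" using zt cl by (simp add: m_assoc)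
      then have "z \<in> lower_central G i"
        using x(1) zt(2) R(2) normal_imp_subgroup[OF lower_central_normal[of i]]
        by (metis subgroup.m_closed subgroup.m_inv_closed subsetD)
      moreover have "?q z \<in> center (G Mod M)"
        using zt(1) unfolding ni nat_upper_central.simps next_center_def M_def by blast
      ultimately have "?q z \<in> N \<inter> center (G Mod M)" by (auto simp: N_def)
      moreover have "c = ?q z \<otimes>\<^bsub>G Mod M\<^esub> ?q t" using x zt cl q.hom_mult by simp
      ultimately show "c \<in> (N \<inter> center (G Mod M)) <#>\<^bsub>G Mod M\<^esub> (?q ` R)"
        using zt(2) unfolding set_mult_def by blast
    qed
    show "finite (?q ` T)" "?q ` T \<subseteq> carrier (G Mod M)" using T by (auto simp: qsurj)
    show "carrier (G Mod M) \<subseteq> {c \<in> carrier (G Mod M). \<forall>a\<in>N. c \<otimes>\<^bsub>G Mod M\<^esub> a = a \<otimes>\<^bsub>G Mod M\<^esub> c}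
        <#>\<^bsub>G Mod M\<^esub> (?q ` T)"
    proof
      fix c assume "c \<in> carrier (G Mod M)"
      then obtain x where x: "x \<in> carrier G" "c = ?q x" by (auto simp: qsurj)
      then obtain z t where zt: "z \<in> nat_upper_central G n" "t \<in> T" "x = z \<otimes> t"
        using T(3) by (auto simp: set_mult_def)
      have cl: "z \<in> carrier G" "t \<in> carrier G"
        using zt T(2) nat_upper_central_carrier by blast+
      have "?q z \<otimes>\<^bsub>G Mod M\<^esub> ?q a = ?q a \<otimes>\<^bsub>G Mod M\<^esub> ?q z" if a: "a \<in> lower_central G i" for a
        using lower_upper_commutator[OF a zt(1)] com[of a z] a li cl by (auto simp: M_def)
      then have "?q z \<in> {c \<in> carrier (G Mod M). \<forall>a\<in>N. c \<otimes>\<^bsub>G Mod M\<^esub> a = a \<otimes>\<^bsub>G Mod M\<^esub> c}"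
        using cl by (auto simp: N_def)
      moreover have "c = ?q z \<otimes>\<^bsub>G Mod M\<^esub> ?q t" using x zt cl q.hom_mult by simp
      ultimately show "c \<in> {c \<in> carrier (G Mod M). \<forall>a\<in>N. c \<otimes>\<^bsub>G Mod M\<^esub> a = a \<otimes>\<^bsub>G Mod M\<^esub> c}
        <#>\<^bsub>G Mod M\<^esub> (?q ` T)"
        using zt(2) unfolding set_mult_def by blast
    qed
  qed
  define S where "S = {commutator G a g | a g. a \<in> lower_central G i \<and> g \<in> carrier G}"
  have Sc: "S \<subseteq> carrier G" using li by (auto simp: S_def)
  have "?q ` S \<subseteq> {commutator (G Mod M) a g | a g. a \<in> N \<and> g \<in> carrier (G Mod M)}"
  proof
    fix c assume "c \<in> ?q ` S"
    then obtain a g where ag: "a \<in> lower_central G i" "g \<in> carrier G" "c = ?q (commutator G a g)"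
      by (auto simp: S_def)
    then have "c = commutator (G Mod M) (?q a) (?q g)" using q.hom_commutator li by blast
    then show "c \<in> {commutator (G Mod M) a g | a g. a \<in> N \<and> g \<in> carrier (G Mod M)}"
      using ag unfolding N_def qsurj by blast
  qed
  then have "generate (G Mod M) (?q ` S) \<subseteq>
      generate (G Mod M) {commutator (G Mod M) a g | a g. a \<in> N \<and> g \<in> carrier (G Mod M)}"
    by (rule Q.mono_generate)
  then have "finite (?q ` generate G S)"
    using q.generate_img[OF Sc] finite_subset[OF _ fin] by simp
  then have "finite (?q ` lower_central G (Suc i))" by (simp add: S_def)
  then show ?case
    using cover_by_representatives[OF M.subgroup_axioms lower_central_carrier[of "Suc i"]]
    unfolding M_def by metis
qed

lemma lower_central_finite_stable:
  assumes "finite T" "T \<subseteq> carrier G" "carrier G \<subseteq> nat_upper_central G n <#> T"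
  obtains m where "finite (lower_central G m)" "\<And>k. lower_central G m \<subseteq> lower_central G k"
proof -
  obtain T' where T': "finite T'" "T' \<subseteq> carrier G" "lower_central G n \<subseteq> {\<one>} <#> T'"
    using lower_central_cover[OF assms, of n] lower_central_carrier[of n] by auto
  have "{\<one>} <#> T' \<subseteq> T'" using T'(2) by (auto simp: set_mult_def subsetD)
  then have fin: "finite (lower_central G n)" using T' finite_subset by metis
  obtain m where m: "n \<le> m" "\<And>k. n \<le> k \<Longrightarrow> card (lower_central G m) \<le> card (lower_central G k)"
    using ex_has_least_nat[of "\<lambda>k. n \<le> k" n "\<lambda>k. card (lower_central G k)"] by auto
  have fm: "finite (lower_central G m)"
    using fin lower_central_antimono[OF m(1)] finite_subset by blast
  have "lower_central G m \<subseteq> lower_central G k" for k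
  proof (cases "k \<le> m")
    case False
    then have "lower_central G k \<subseteq> lower_central G m" "card (lower_central G m) \<le> card (lower_central G k)"
      using lower_central_antimono[of m k] m by auto
    then show ?thesis using card_seteq[OF fm] by blast
  qed (rule lower_central_antimono)
  then show thesis using that fm by blast
qed

section \<open>Construction of the finite normal subgroup\<close>

text \<open>
  The subgroup in question is \<open>L = lower_central U m\<close> for a finitely generated \<open>U\<close> that covers \<open>G\<close>
  modulo the hypercenter \<open>Z\<close>, with \<open>m\<close> so large that this term is finite and the lower series of \<open>U\<close> is
  constant from there on. That \<open>U\<close> comes along with \<open>L\<close> matters later: the action of \<open>U\<close> on \<open>L\<close> is what forces
  \<open>L \<inter> Z\<close> into the derived subgroup of \<open>L\<close>.
\<close>

lemma finite_residual_exists: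
  assumes "finite (carrier (G Mod upper_hypercenter G))"
  obtains U m where "subgroup U G"
    "upper_hypercenter G \<inter> U \<subseteq> (\<Union>n. nat_upper_central (G\<lparr>carrier := U\<rparr>) n)"
    "finite (lower_central (G\<lparr>carrier := U\<rparr>) m)"
    "\<And>k. lower_central (G\<lparr>carrier := U\<rparr>) m \<subseteq> lower_central (G\<lparr>carrier := U\<rparr>) k"
    "lower_central (G\<lparr>carrier := U\<rparr>) m \<lhd> G"
    "\<And>z x. z \<in> upper_hypercenter G \<Longrightarrow> x \<in> lower_central (G\<lparr>carrier := U\<rparr>) m \<Longrightarrow> x \<otimes> z = z \<otimes> x"
    "hypercentral (G Mod lower_central (G\<lparr>carrier := U\<rparr>) m)"
proof -
  define Z where "Z = upper_hypercenter G"
  have Z: "Z \<lhd> G" unfolding Z_def by (rule upper_hypercenter_is_last_term(2)[OF is_group])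
  interpret Z: normal Z G by (rule Z)
  obtain S n T where S: "finite S" "S \<subseteq> carrier G" "carrier G \<subseteq> Z <#> generate G S"
    and T: "finite T" "T \<subseteq> generate G S"
      "generate G S \<subseteq> nat_upper_central (G\<lparr>carrier := generate G S\<rparr>) n <#> T"
    using upper_hypercenter_finite_index_generators[OF assms] unfolding Z_def by metis
  define U where "U = generate G S"
  have U: "subgroup U G" unfolding U_def by (rule generate_is_subgroup[OF S(2)])
  interpret sU: subgroup U G by (rule U)
  interpret U: group "G\<lparr>carrier := U\<rparr>" by (rule subgroup_imp_group[OF U])
  let ?lc = "lower_central (G\<lparr>carrier := U\<rparr>)"
  obtain m where m: "finite (?lc m)" "\<And>k. ?lc m \<subseteq> ?lc k"
    using U.lower_central_finite_stable[OF T(1), of n] T(2,3) unfolding U_def by auto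
  define L where "L = ?lc m"
  have LU: "L \<subseteq> U" using U.lower_central_carrier by (auto simp: L_def)
  have LnU: "L \<lhd> G\<lparr>carrier := U\<rparr>" unfolding L_def by (rule U.lower_central_normal)
  have L: "subgroup L G" using incl_subgroup[OF U normal_imp_subgroup[OF LnU]] .
  interpret sL: subgroup L G by (rule L)
  have ZU: "\<exists>z u. z \<in> Z \<and> u \<in> U \<and> g = z \<otimes> u" if "g \<in> carrier G" for g
    using S(3) that by (auto simp: set_mult_def U_def)
  have central: "x \<otimes> z = z \<otimes> x" if z: "z \<in> Z" and x: "x \<in> L" for z x
  proof -
    \<comment> \<open>Enlarging \<open>U\<close> by \<open>z\<close> keeps it finitely generated, so that \<open>z\<close> lies in a finite stage \<open>k\<close> there,
      while \<open>L\<close> still lies in every term of the lower central series.\<close>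
    define V where "V = generate G (insert z S)"
    have S': "finite (insert z S)" "insert z S \<subseteq> carrier G" using S z by auto
    have V: "subgroup V G" unfolding V_def by (rule generate_is_subgroup[OF S'(2)])
    interpret V: group "G\<lparr>carrier := V\<rparr>" by (rule subgroup_imp_group[OF V])
    have UV: "U \<subseteq> V" unfolding U_def V_def by (rule mono_generate) blast
    have zV: "z \<in> V" unfolding V_def by (rule generate.incl) simp
    obtain k where k: "z \<in> nat_upper_central (G\<lparr>carrier := V\<rparr>) k"
      using upper_hypercenter_Int_generate[OF S'] z zV unfolding Z_def V_def by blast
    have "x \<in> lower_central (G\<lparr>carrier := V\<rparr>) k"
      using x m(2)[of k] lower_central_subgroup_mono[OF U V UV] by (auto simp: L_def)
    then have "commutator (G\<lparr>carrier := V\<rparr>) x z \<in> nat_upper_central (G\<lparr>carrier := V\<rparr>) (k - Suc k)"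
      using V.lower_upper_commutator k by blast
    moreover have "x \<in> V" using x LU UV by blast
    ultimately have "commutator G x z = \<one>" using commutator_subgroup[OF V _ zV] by simp
    then show ?thesis using commutator_eq_one_iff x z by simp
  qed
  have LG: "L \<lhd> G"
  proof (rule normal_invI[OF L])
    fix g h assume g: "g \<in> carrier G" and h: "h \<in> L"
    obtain z u where zu: "z \<in> Z" "u \<in> U" "g = z \<otimes> u" using ZU[OF g] by blast
    have h': "u \<otimes> h \<otimes> inv u \<in> L"
      using normal.inv_op_closed2[OF LnU, of u h] zu h m_inv_consistent[OF U] by simp
    have "g \<otimes> h \<otimes> inv g = z \<otimes> (u \<otimes> h \<otimes> inv u) \<otimes> inv z"
      using zu h by (simp add: word_simps)
    also have "\<dots> = (u \<otimes> h \<otimes> inv u) \<otimes> z \<otimes> inv z" using central[OF zu(1) h'] by simp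
    finally show "g \<otimes> h \<otimes> inv g \<in> L" using h' zu h by (simp add: m_assoc)
  qed
  interpret nL: normal L G by (rule LG)
  interpret Q: group "G Mod L" by (rule nL.factorgroup_is_group)
  interpret q: group_hom G "G Mod L" "\<lambda>x. L #> x" by (rule nL.coset_group_hom)
  note [simp del] = mult_FactGroup
  have H: "subgroup (upper_hypercenter (G Mod L)) (G Mod L)"
    using upper_hypercenter_is_last_term(2)[OF Q.is_group] normal_imp_subgroup by blast
  interpret sH: subgroup "upper_hypercenter (G Mod L)" "G Mod L" by (rule H)
  \<comment> \<open>The preimage of the hypercenter of \<open>G Mod L\<close>. It is closed under the rule that generates the
    hypercenter of \<open>G\<close>, so it contains \<open>Z\<close>.\<close>
  define W where "W = {x \<in> carrier G. L #> x \<in> upper_hypercenter (G Mod L)}"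
  have W: "subgroup W G"
  proof (rule subgroupI)
    show "W \<noteq> {}" using q.hom_one sH.one_closed by (auto simp: W_def intro!: exI[of _ \<one>])
    show "inv a \<in> W" if "a \<in> W" for a using that q.hom_inv sH.m_inv_closed by (auto simp: W_def)
    show "a \<otimes> b \<in> W" if "a \<in> W" "b \<in> W" for a b
      using that q.hom_mult sH.m_closed by (auto simp: W_def)
  qed (auto simp: W_def)
  interpret W: subgroup W G by (rule W)
  have Wclosed: "x \<in> W" if x: "x \<in> carrier G" and com: "\<And>y. y \<in> carrier G \<Longrightarrow> commutator G x y \<in> W" for x
  proof -
    have "L #> x \<in> upper_hypercenter (G Mod L)"
    proof (rule Q.upper_hypercenter_closed)
      fix y assume "y \<in> carrier (G Mod L)"
      then obtain y' where y': "y' \<in> carrier G" "y = L #> y'" by (auto simp: carrier_FactGroup)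
      have "L #> commutator G x y' \<in> upper_hypercenter (G Mod L)"
        using com[OF y'(1)] unfolding W_def by blast
      then show "commutator (G Mod L) (L #> x) y \<in> upper_hypercenter (G Mod L)"
        unfolding y'(2) q.hom_commutator[OF x y'(1)] .
    qed (rule q.hom_closed[OF x])
    then show ?thesis using x unfolding W_def by blast
  qed
  have ZW: "Z \<subseteq> W" unfolding Z_def using upper_hypercenter_least[of W] Wclosed W.one_closed by blast
  have LW: "L \<subseteq> W"
  proof
    fix x assume x: "x \<in> L"
    then have "L #> x = \<one>\<^bsub>G Mod L\<^esub>" using sL.rcos_const[OF is_group x] by simp
    then have "L #> x \<in> upper_hypercenter (G Mod L)" using sH.one_closed by metis
    then show "x \<in> W" using sL.mem_carrier[OF x] unfolding W_def by blast
  qed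
  \<comment> \<open>Ascend from \<open>L\<close> to \<open>U\<close> along the lower series of \<open>U\<close>; the commutator with \<open>y = z u\<close> differs from
    the one with \<open>u\<close> by elements of \<open>Z\<close> only.\<close>
  have "?lc (m - j) \<subseteq> W" if "j \<le> m" for j
    using that
  proof (induction j)
    case 0
    then show ?case using LW by (simp add: L_def)
  next
    case (Suc j)
    show ?case
    proof
      fix x assume x: "x \<in> ?lc (m - Suc j)"
      then have xU: "x \<in> U" using U.lower_central_carrier by auto
      show "x \<in> W"
      proof (rule Wclosed)
        fix y assume y: "y \<in> carrier G"
        obtain z u where zu: "z \<in> Z" "u \<in> U" "y = z \<otimes> u" using ZU[OF y] by blast
        have "commutator (G\<lparr>carrier := U\<rparr>) x u \<in> ?lc (Suc (m - Suc j))"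
          by (rule U.lower_central_commutator[OF x]) (use zu in simp)
        then have d: "commutator G x u \<in> W"
          using Suc commutator_subgroup[OF U xU zu(2)] by (auto simp: Suc_diff_Suc)
        have "commutator G z (commutator G x u) \<in> W" "commutator G x z \<in> W"
          using ZW commutator_in_normal[OF Z] zu xU d by auto
        moreover have "commutator G x y =
            commutator G x z \<otimes> commutator G z (commutator G x u) \<otimes> commutator G x u"
          using zu xU by (simp add: commutator_def word_simps)
        ultimately show "commutator G x y \<in> W" using d by simp
      qed (use xU in simp)
    qed
  qed
  from this[of m] have UW: "U \<subseteq> W" by simp
  have "x \<in> W" if "x \<in> carrier G" for x using ZU[OF that] UW ZW by auto
  then have "carrier (G Mod L) \<subseteq> upper_hypercenter (G Mod L)"
    unfolding W_def carrier_FactGroup by blast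
  then have hc: "hypercentral (G Mod L)" using sH.subset by (auto simp: hypercentral_def)
  show thesis
  proof (rule that[OF U _ m(1) m(2)])
    show "upper_hypercenter G \<inter> U \<subseteq> (\<Union>n. nat_upper_central (G\<lparr>carrier := U\<rparr>) n)"
      unfolding U_def by (rule upper_hypercenter_Int_generate[OF S(1,2)])
  qed (use LG central hc in \<open>simp_all add: L_def Z_def\<close>)
qed

section \<open>Perfect sections\<close>

text \<open>
  Here \<open>A/B\<close> is a finite abelian section on which \<open>G\<close> acts as a nilpotent group, and
  \<open>A/B = [A/B, G]\<close>. Unless \<open>A = B\<close>, the action is nontrivial, and there is a \<open>z\<close> that acts nontrivially while
  all its commutators act trivially: take it from the last term of the lower series that acts
  nontrivially. Then \<open>a \<mapsto> [a,z]\<close> is an endomorphism \<open>f\<close> of \<open>A/B\<close> commuting with \<open>G\<close>. If \<open>f\<close> is onto, it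
  is injective by finiteness, so already \<open>z\<close> has no nontrivial fixed point. Otherwise its image \<open>C/B\<close> is a
  proper nontrivial subgroup; both \<open>A/C\<close> and \<open>C/B\<close> are quotients of \<open>A/B\<close> and so inherit the
  hypotheses, and a fixed point lies in \<open>C\<close> by induction for \<open>A/C\<close> and then in \<open>B\<close> by induction for \<open>C/B\<close>.

  Working with pairs of normal subgroups instead of quotient groups keeps this induction inside \<open>G\<close>.
\<close>

lemma trivial_fixed_points_of_perfect_section:
  assumes "A \<lhd> G" "B \<lhd> G" "B \<subseteq> A" "finite A"
    and "\<And>a b. a \<in> A \<Longrightarrow> b \<in> A \<Longrightarrow> commutator G a b \<in> B"
    and "A \<subseteq> generate G ({commutator G a g | a g. a \<in> A \<and> g \<in> carrier G} \<union> B)"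
    and "\<And>a c. a \<in> A \<Longrightarrow> c \<in> lower_central G m \<Longrightarrow> commutator G a c \<in> B"
    and "x \<in> A" "\<And>g. g \<in> carrier G \<Longrightarrow> commutator G x g \<in> B"
  shows "x \<in> B"
  using assms
proof (induction "card A - card B" arbitrary: A B x rule: less_induct)
  case less
  note A = less.prems(1) and B = less.prems(2) and BA = less.prems(3) and fin = less.prems(4)
    and ab = less.prems(5) and perf = less.prems(6) and nil = less.prems(7) and x = less.prems(8,9)
  interpret nA: normal A G by (rule A)
  interpret nB: normal B G by (rule B)
  show ?case
  proof (cases "A \<subseteq> B")
    case True
    then show ?thesis using x by blast
  next
    case notAB: False
    have "\<not> (\<forall>a \<in> A. \<forall>c \<in> lower_central G 0. commutator G a c \<in> B)"
    proof
      assume "\<forall>a \<in> A. \<forall>c \<in> lower_central G 0. commutator G a c \<in> B"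
      then have "{commutator G a g | a g. a \<in> A \<and> g \<in> carrier G} \<union> B \<subseteq> B" by auto
      then have "A \<subseteq> B" using perf generate_subgroup_incl[OF _ nB.subgroup_axioms] by blast
      then show False using notAB by blast
    qed
    moreover have "\<forall>a \<in> A. \<forall>c \<in> lower_central G m. commutator G a c \<in> B" using nil by blast
    ultimately obtain i where i: "\<not> (\<forall>a \<in> A. \<forall>c \<in> lower_central G i. commutator G a c \<in> B)"
      "\<forall>a \<in> A. \<forall>c \<in> lower_central G (Suc i). commutator G a c \<in> B"
      using ex_least_nat_less[of "\<lambda>i. \<forall>a \<in> A. \<forall>c \<in> lower_central G i. commutator G a c \<in> B" m]
      by blast
    then obtain a0 z where a0: "a0 \<in> A" "z \<in> lower_central G i" "commutator G a0 z \<notin> B" by blast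
    have z: "z \<in> carrier G" using a0(2) lower_central_carrier by blast
    interpret Q: group "G Mod B" by (rule nB.factorgroup_is_group)
    interpret q: group_hom G "G Mod B" "\<lambda>x. B #> x" by (rule nB.coset_group_hom)
    note [simp del] = mult_FactGroup one_FactGroup
    define q where "q = (\<lambda>x. B #> x)"
    define f where "f = (\<lambda>a. commutator G a z)"
    have q_mult: "q (u \<otimes> v) = q u \<otimes>\<^bsub>G Mod B\<^esub> q v" if "u \<in> carrier G" "v \<in> carrier G" for u v
      using that q.hom_mult by (simp add: q_def)
    have q_closed: "q u \<in> carrier (G Mod B)" if "u \<in> carrier G" for u
      using that q.hom_closed by (simp add: q_def)
    have q_inv: "q (inv u) = inv\<^bsub>G Mod B\<^esub> q u" if "u \<in> carrier G" for u
      using that q.hom_inv by (simp add: q_def)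
    have q_one: "q u = \<one>\<^bsub>G Mod B\<^esub> \<longleftrightarrow> u \<in> B" if "u \<in> carrier G" for u
      using that coset_eq_iff[OF nB.subgroup_axioms that, of \<one>] nB.subset q.hom_one by (simp add: q_def)
    have q_eq: "q u = q v \<longleftrightarrow> u \<otimes> inv v \<in> B" if "u \<in> carrier G" "v \<in> carrier G" for u v
      using coset_eq_iff[OF nB.subgroup_axioms] that by (simp add: q_def)
    have q_com: "q u \<otimes>\<^bsub>G Mod B\<^esub> q v = q v \<otimes>\<^bsub>G Mod B\<^esub> q u"
      if "u \<in> carrier G" "v \<in> carrier G" "commutator G u v \<in> B" for u v
      using commute_mod_iff[OF B that(1,2)] that(3) unfolding q_def by blast
    have fA: "f a \<in> A" if "a \<in> A" for a
      unfolding f_def by (rule commutator_in_normal[OF A]) (use that z in auto)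
    have fB: "f b \<in> B" if "b \<in> B" for b
      unfolding f_def by (rule commutator_in_normal[OF B]) (use that z in auto)
    have f1: "f \<one> = \<one>" using z by (simp add: f_def)
    have qf_mult: "q (f (a \<otimes> b)) = q (f a) \<otimes>\<^bsub>G Mod B\<^esub> q (f b)" if "a \<in> A" "b \<in> A" for a b
    proof -
      have cl: "a \<in> carrier G" "b \<in> carrier G" "f a \<in> carrier G" "f b \<in> carrier G" using that fA by simp_all
      note qcl = q_closed[OF cl(1)] q_closed[OF cl(3)] q_closed[OF cl(4)]
      have "f (a \<otimes> b) = (a \<otimes> f b) \<otimes> inv a \<otimes> f a"
        using that z by (simp add: f_def commutator_def word_simps)
      then have "q (f (a \<otimes> b)) = (q a \<otimes>\<^bsub>G Mod B\<^esub> q (f b)) \<otimes>\<^bsub>G Mod B\<^esub> inv\<^bsub>G Mod B\<^esub> q a \<otimes>\<^bsub>G Mod B\<^esub> q (f a)"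
        using cl by (simp add: q_mult q_inv)
      also have "q a \<otimes>\<^bsub>G Mod B\<^esub> q (f b) = q (f b) \<otimes>\<^bsub>G Mod B\<^esub> q a"
        by (rule q_com[OF cl(1,4) ab[OF that(1) fA[OF that(2)]]])
      also have "q (f b) \<otimes>\<^bsub>G Mod B\<^esub> q a \<otimes>\<^bsub>G Mod B\<^esub> inv\<^bsub>G Mod B\<^esub> q a \<otimes>\<^bsub>G Mod B\<^esub> q (f a) =
          q (f b) \<otimes>\<^bsub>G Mod B\<^esub> q (f a)"
        using qcl by (simp add: Q.m_assoc)
      also have "\<dots> = q (f a) \<otimes>\<^bsub>G Mod B\<^esub> q (f b)"
        by (rule q_com[OF cl(4,3) ab[OF fA[OF that(2)] fA[OF that(1)]]])
      finally show ?thesis .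
    qed
    have qf_inv: "q (f (inv a)) = inv\<^bsub>G Mod B\<^esub> q (f a)" if "a \<in> A" for a
    proof -
      have "q (f (inv a)) \<otimes>\<^bsub>G Mod B\<^esub> q (f a) = q (f (inv a \<otimes> a))"
        using qf_mult[of "inv a" a] that by simp
      also have "\<dots> = \<one>\<^bsub>G Mod B\<^esub>" using that f1 q_one[of \<one>] by simp
      finally show ?thesis
        using Q.inv_equality[of "q (f (inv a))" "q (f a)"] q_closed fA that by simp
    qed
    have qf_conj: "q (f (g \<otimes> a \<otimes> inv g)) = q (g \<otimes> f a \<otimes> inv g)" if g: "g \<in> carrier G" and a: "a \<in> A" for g a
    proof -
      define a' where "a' = g \<otimes> a \<otimes> inv g"
      define c where "c = commutator G g z"
      have a': "a' \<in> A" using nA.inv_op_closed2[OF g a] by (simp add: a'_def)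
      have "commutator G z g \<in> lower_central G (Suc i)" by (rule lower_central_commutator[OF a0(2) g])
      then have c: "c \<in> lower_central G (Suc i)"
        unfolding c_def using commutator_swap_mem[OF normal_imp_subgroup[OF lower_central_normal] z g] by blast
      have cl: "a' \<in> carrier G" "c \<in> carrier G" "f a' \<in> carrier G"
        using a' fA z g by (simp_all add: c_def)
      have "g \<otimes> f a \<otimes> inv g = commutator G a' (g \<otimes> z \<otimes> inv g)"
        unfolding f_def a'_def by (rule commutator_conj) (use g a z in simp_all)
      also have "g \<otimes> z \<otimes> inv g = c \<otimes> z" using g z by (simp add: c_def commutator_def word_simps)
      also have "commutator G a' (c \<otimes> z) = commutator G a' c \<otimes> (c \<otimes> f a' \<otimes> inv c)"
        using cl z by (simp add: f_def commutator_def word_simps)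
      finally have "q (g \<otimes> f a \<otimes> inv g) =
          q (commutator G a' c) \<otimes>\<^bsub>G Mod B\<^esub> (q c \<otimes>\<^bsub>G Mod B\<^esub> q (f a') \<otimes>\<^bsub>G Mod B\<^esub> inv\<^bsub>G Mod B\<^esub> q c)"
        using cl by (simp add: q_mult q_inv)
      also have "q (commutator G a' c) = \<one>\<^bsub>G Mod B\<^esub>" using q_one i(2) a' c cl by simp
      also have "q c \<otimes>\<^bsub>G Mod B\<^esub> q (f a') = q (f a') \<otimes>\<^bsub>G Mod B\<^esub> q c"
        using q_com[of "f a'" c] cl i(2) fA[OF a'] c by simp
      finally show ?thesis using cl q_closed by (simp add: Q.m_assoc a'_def)
    qed
    define C where "C = {x \<in> A. \<exists>a \<in> A. q x = q (f a)}"
    have CI: "u \<in> C" if "u \<in> A" "a \<in> A" "q u = q (f a)" for u a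
      using that unfolding C_def by (intro CollectI conjI bexI)
    have CE: thesis if "u \<in> C" "\<And>a. a \<in> A \<Longrightarrow> q u = q (f a) \<Longrightarrow> u \<in> A \<Longrightarrow> thesis" for u thesis
      using that(1) unfolding C_def by (elim CollectE conjE bexE) (rule that(2))
    have CA: "C \<subseteq> A" by (auto simp: C_def)
    have fC: "f a \<in> C" if "a \<in> A" for a using CI[OF fA[OF that] that] by simp
    have BC: "B \<subseteq> C"
    proof
      fix b assume b: "b \<in> B"
      then have "q b = q (f \<one>)" using f1 q_one[of \<one>] q_one[of b] by simp
      then show "b \<in> C" using CI[OF _ nA.one_closed] b BA by auto
    qed
    have sC: "subgroup C G"
    proof (rule subgroupI)
      show "C \<subseteq> carrier G" "C \<noteq> {}" using CA nA.subset BC nB.one_closed by blast+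
      show "inv u \<in> C" if "u \<in> C" for u
      proof -
        obtain a where a: "a \<in> A" "q u = q (f a)" "u \<in> A" by (rule CE[OF \<open>u \<in> C\<close>])
        then have "q (inv u) = q (f (inv a))" using q_inv qf_inv by simp
        then show ?thesis using CI[of "inv u" "inv a"] a by simp
      qed
      show "u \<otimes> v \<in> C" if "u \<in> C" "v \<in> C" for u v
      proof -
        obtain a where a: "a \<in> A" "q u = q (f a)" "u \<in> A" by (rule CE[OF \<open>u \<in> C\<close>])
        obtain b where b: "b \<in> A" "q v = q (f b)" "v \<in> A" by (rule CE[OF \<open>v \<in> C\<close>])
        have "q (u \<otimes> v) = q (f (a \<otimes> b))" using a b by (simp add: q_mult qf_mult)
        then show ?thesis using CI[of "u \<otimes> v" "a \<otimes> b"] a b by simp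
      qed
    qed
    have C: "C \<lhd> G"
    proof (rule normal_invI[OF sC])
      fix g u assume g: "g \<in> carrier G" and "u \<in> C"
      obtain a where a: "a \<in> A" "q u = q (f a)" "u \<in> A" by (rule CE[OF \<open>u \<in> C\<close>])
      have "q (g \<otimes> u \<otimes> inv g) = q (f (g \<otimes> a \<otimes> inv g))"
        using g a fA[OF a(1)] by (simp add: qf_conj q_mult q_inv)
      then show "g \<otimes> u \<otimes> inv g \<in> C"
        using CI[OF nA.inv_op_closed2[OF g a(3)] nA.inv_op_closed2[OF g a(1)]] by simp
    qed
    show ?thesis
    proof (cases "C = A")
      case True
      \<comment> \<open>The map induced by \<open>f\<close> on the finite set of cosets is onto, hence injective.\<close>
      define s where "s = (\<lambda>D. SOME a. a \<in> A \<and> q a = D)"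
      have s: "s (q a) \<in> A \<and> q (s (q a)) = q a" if "a \<in> A" for a
        unfolding s_def by (rule someI[of _ a]) (use that in simp)
      have qf_cong: "q (f a) = q (f b)" if "a \<in> A" "b \<in> A" "q a = q b" for a b
      proof -
        have "a \<otimes> inv b \<in> B" using that q_eq by simp
        then have "q (f (a \<otimes> inv b)) = \<one>\<^bsub>G Mod B\<^esub>" using fB q_one by simp
        moreover have "q (f ((a \<otimes> inv b) \<otimes> b)) = q (f (a \<otimes> inv b)) \<otimes>\<^bsub>G Mod B\<^esub> q (f b)"
          using that by (intro qf_mult) auto
        moreover have "(a \<otimes> inv b) \<otimes> b = a" using that by (simp add: m_assoc)
        ultimately show ?thesis using q_closed fA that by simp
      qed
      have sf: "q (f (s (q a))) = q (f a)" if "a \<in> A" for a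
        using qf_cong[of "s (q a)" a] s[OF that] that by blast
      have "q ` A \<subseteq> (\<lambda>D. q (f (s D))) ` (q ` A)"
      proof
        fix D assume "D \<in> q ` A"
        then obtain u where "u \<in> C" "D = q u" using True by (elim imageE) simp
        obtain a where "a \<in> A" "D = q (f a)" using CE[OF \<open>u \<in> C\<close>] \<open>D = q u\<close> by metis
        then show "D \<in> (\<lambda>D. q (f (s D))) ` (q ` A)" using sf by (auto intro!: image_eqI)
      qed
      then have inj: "inj_on (\<lambda>D. q (f (s D))) (q ` A)"
        by (rule finite_surj_inj[rotated]) (use fin in simp)
      have "f x \<in> B" using x(2)[OF z] by (simp add: f_def)
      then have "q (f x) = q (f \<one>)"
        using x(1) fA f1 q_one[of \<one>] q_one[of "f x"] by simp
      then have "q (f (s (q x))) = q (f (s (q \<one>)))"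
        by (simp only: sf[OF x(1)] sf[OF nA.one_closed])
      then have "q x = q \<one>" by (rule inj_onD[OF inj]) (use x(1) in simp_all)
      then show ?thesis using q_one[of \<one>] q_one[of x] x(1) by simp
    next
      case False
      have fC': "finite C" using fin CA finite_subset by blast
      have "C \<noteq> B" using fC[OF a0(1)] a0(3) by (auto simp: f_def)
      then have cards: "card B < card C" "card C < card A"
        using psubset_card_mono[OF fC', of B] psubset_card_mono[OF fin, of C] BC CA False by auto
      have xC: "x \<in> C"
      proof (rule less.hyps[OF _ A C CA fin])
        show "card A - card C < card A - card B" using cards by arith
        show "A \<subseteq> generate G ({commutator G a g |a g. a \<in> A \<and> g \<in> carrier G} \<union> C)"
          using perf mono_generate[of "{commutator G a g |a g. a \<in> A \<and> g \<in> carrier G} \<union> B"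
            "{commutator G a g |a g. a \<in> A \<and> g \<in> carrier G} \<union> C"] BC by blast
        show "commutator G a b \<in> C" if "a \<in> A" "b \<in> A" for a b
          using subsetD[OF BC ab[OF that]] .
        show "commutator G a c \<in> C" if "a \<in> A" "c \<in> lower_central G m" for a c
          using subsetD[OF BC nil[OF that]] .
        show "x \<in> A" by (rule x(1))
        show "commutator G x g \<in> C" if "g \<in> carrier G" for g
          using subsetD[OF BC x(2)[OF that]] .
      qed
      \<comment> \<open>\<open>P/B = [C/B, G]\<close>. The elements that \<open>f\<close> maps into \<open>P\<close> include \<open>[A,G]\<close> and \<open>B\<close>, hence all of \<open>A\<close>.\<close>
      define P where "P = generate G ({commutator G a g |a g. a \<in> C \<and> g \<in> carrier G} \<union> B)"
      have P: "subgroup P G"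
        unfolding P_def by (rule generate_is_subgroup) (use CA in auto)
      interpret sP: subgroup P G by (rule P)
      have BP: "B \<subseteq> P" unfolding P_def by (auto intro: generate.incl)
      have P_cong: "u \<in> P" if "u \<in> carrier G" "v \<in> P" "q u = q v" for u v
      proof -
        have "u \<otimes> inv v \<in> P" using that q_eq BP by auto
        then have "u \<otimes> inv v \<otimes> v \<in> P" using that by blast
        then show ?thesis using that by (simp add: m_assoc)
      qed
      define D where "D = {a \<in> A. f a \<in> P}"
      have D: "subgroup D G"
      proof (rule subgroupI)
        show "D \<subseteq> carrier G" "D \<noteq> {}" using f1 by (auto simp: D_def intro!: exI[of _ \<one>])
        show "inv a \<in> D" if "a \<in> D" for a
        proof -
          have a: "a \<in> A" "f a \<in> P" using that by (auto simp: D_def)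
          have "f (inv a) \<in> P"
            by (rule P_cong[of _ "inv (f a)"]) (use a fA qf_inv q_inv in simp_all)
          then show ?thesis using a by (simp add: D_def)
        qed
        show "a \<otimes> b \<in> D" if "a \<in> D" "b \<in> D" for a b
        proof -
          have a: "a \<in> A" "f a \<in> P" and b: "b \<in> A" "f b \<in> P" using that by (auto simp: D_def)
          have "f (a \<otimes> b) \<in> P"
            by (rule P_cong[of _ "f a \<otimes> f b"]) (use a b fA qf_mult q_mult in simp_all)
          then show ?thesis using a b by (simp add: D_def)
        qed
      qed
      have "commutator G a g \<in> D" if a: "a \<in> A" and g: "g \<in> carrier G" for a g
      proof -
        define b where "b = g \<otimes> inv a \<otimes> inv g"
        have b: "b \<in> A" unfolding b_def using nA.inv_op_closed2[OF g] a by simp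
        have e: "commutator G a g = a \<otimes> b" using a g by (simp add: b_def commutator_def word_simps)
        have cl: "f a \<in> carrier G" "f (inv a) \<in> carrier G" using a fA by simp_all
        have "q (f (a \<otimes> b)) = q (f a) \<otimes>\<^bsub>G Mod B\<^esub> q (g \<otimes> f (inv a) \<otimes> inv g)"
          using qf_mult[OF a b] qf_conj[OF g, of "inv a"] a by (simp add: b_def)
        also have "\<dots> = q (f a \<otimes> (g \<otimes> inv (f a) \<otimes> inv g))"
          using cl g a by (simp add: q_mult q_inv qf_inv)
        also have "f a \<otimes> (g \<otimes> inv (f a) \<otimes> inv g) = commutator G (f a) g"
          using cl g by (simp add: commutator_def word_simps)
        finally have eq: "q (f (a \<otimes> b)) = q (commutator G (f a) g)" .
        have "commutator G (f a) g \<in> P"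
          unfolding P_def using fC[OF a] g by (auto intro!: generate.incl)
        then have "f (a \<otimes> b) \<in> P" using P_cong[OF _ _ eq] fA a b by simp
        then show ?thesis using e a b by (simp add: D_def)
      qed
      moreover have "B \<subseteq> D" using fB BP BA by (auto simp: D_def)
      ultimately have "{commutator G a g |a g. a \<in> A \<and> g \<in> carrier G} \<union> B \<subseteq> D" by blast
      then have AD: "A \<subseteq> D" by (rule order_trans[OF perf generate_subgroup_incl[OF _ D]])
      have "f a \<in> P" if "a \<in> A" for a using subsetD[OF AD that] unfolding D_def by simp
      then have "u \<in> P" if "u \<in> C" for u
        using CE[OF that] P_cong nA.mem_carrier by metis
      then have "C \<subseteq> P" by blast
      show ?thesis
      proof (rule less.hyps[OF _ C B BC fC'])
        show "card C - card B < card A - card B" using cards by arith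
        show "C \<subseteq> generate G ({commutator G a g |a g. a \<in> C \<and> g \<in> carrier G} \<union> B)"
          using \<open>C \<subseteq> P\<close> by (simp add: P_def)
        show "commutator G a b \<in> B" if "a \<in> C" "b \<in> C" for a b
          using ab[OF subsetD[OF CA that(1)] subsetD[OF CA that(2)]] .
        show "commutator G a c \<in> B" if "a \<in> C" "c \<in> lower_central G m" for a c
          using nil[OF subsetD[OF CA that(1)] that(2)] .
        show "x \<in> C" by (rule xC)
        show "commutator G x g \<in> B" if "g \<in> carrier G" for g by (rule x(2)[OF that])
      qed
    qed
  qed
qed

end

section \<open>Derived subgroups of groups of prime power order\<close>

lemma (in group_hom) card_image_times_kernel:
  assumes "finite (carrier G)"
  shows "card (h ` carrier G) * card (kernel G H h) = order G"
proof -
  have img: "subgroup (h ` carrier G) H" by (rule img_is_subgroup)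
  have gh: "group_hom G (H\<lparr>carrier := h ` carrier G\<rparr>) h"
    using img by (intro group_hom.intro group_hom_axioms.intro G.is_group H.subgroup_imp_group) (auto simp: hom_def)
  have k: "kernel G (H\<lparr>carrier := h ` carrier G\<rparr>) h = kernel G H h" by (simp add: kernel_def)
  have "bij_betw (\<lambda>A. the_elem (h ` A)) (rcosets kernel G H h) (h ` carrier G)"
    using group_hom.FactGroup_inj_on[OF gh] group_hom.FactGroup_onto[OF gh]
    by (simp add: bij_betw_def k FactGroup_def)
  then have "card (rcosets kernel G H h) = card (h ` carrier G)" by (rule bij_betw_same_card)
  then show ?thesis using G.lagrange[OF subgroup_kernel] by simp
qed

context group
begin

lemma kernel_coset_map_subgroup:
  assumes K: "subgroup K G" and P: "subgroup P G"
  shows "kernel (G\<lparr>carrier := P\<rparr>) (G Mod K) (\<lambda>x. K #> x) = P \<inter> K"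
proof -
  have eq: "K #> x = K \<longleftrightarrow> x \<in> K" if "x \<in> P" for x
    using coset_eq_iff[OF K, of x \<one>] coset_mult_one[OF subgroup.subset[OF K]]
      subgroup.mem_carrier[OF P that] by simp
  have "kernel (G\<lparr>carrier := P\<rparr>) (G Mod K) (\<lambda>x. K #> x) = {x \<in> P. K #> x = K}"
    by (simp add: kernel_def)
  also have "\<dots> = {x \<in> P. x \<in> K}" by (rule Collect_cong) (simp add: eq cong: conj_cong)
  finally show ?thesis by blast
qed

text \<open>
  Otherwise every conjugacy class except that of \<open>1\<close> would have size divisible by \<open>p\<close>.
\<close>

lemma prime_power_order_center_nontrivial:
  assumes p: "Factorial_Ring.prime (p::nat)" and ord: "order G = p ^ a" and nt: "order G \<noteq> 1"
  shows "\<exists>z \<in> center G. z \<noteq> \<one>"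
proof (rule ccontr)
  assume no: "\<not> ?thesis"
  have fin: "finite (carrier G)" using ord p order_gt_0_iff_finite prime_gt_0_nat by simp
  define \<phi> where "\<phi> = (\<lambda>g. \<lambda>h \<in> carrier G. g \<otimes> h \<otimes> inv g)"
  interpret act: group_action G "carrier G" \<phi> unfolding \<phi>_def by (rule action_by_conjugation)
  have one: "orbit G \<phi> \<one> = {\<one>}"
    by (auto simp: orbit_def \<phi>_def intro!: exI[of _ \<one>])
  have div: "p dvd card B" if B: "B \<in> orbits G (carrier G) \<phi> - {{\<one>}}" for B
  proof -
    obtain x where x: "x \<in> carrier G" "B = orbit G \<phi> x" using B by (auto simp: orbits_def)
    then have "x \<noteq> \<one>" using B one by auto
    then have "x \<notin> center G" using no by blast
    then obtain g where g: "g \<in> carrier G" "x \<otimes> g \<noteq> g \<otimes> x" using x(1) by (auto simp: center_def)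
    have "g \<otimes> x \<otimes> inv g \<noteq> x"
    proof
      assume "g \<otimes> x \<otimes> inv g = x"
      then have "g \<otimes> x \<otimes> inv g \<otimes> g = x \<otimes> g" by simp
      then show False using g x(1) by (simp add: m_assoc)
    qed
    moreover have "g \<otimes> x \<otimes> inv g \<in> B" "x \<in> B"
      using x g act.orbit_refl[OF x(1)] by (auto simp: orbit_def \<phi>_def)
    ultimately have "card B \<noteq> 1" by (auto simp: card_1_singleton_iff)
    moreover have "card B dvd p ^ a"
      using act.orbit_stabilizer_theorem[OF x(1)] ord x(2) by (metis dvd_triv_left)
    ultimately show ?thesis using p by (auto simp: divides_primepow_nat)
  qed
  have finorb: "finite (orbits G (carrier G) \<phi>)" using fin by (auto simp: orbits_def setcompr_eq_image)
  have "order G = (\<Sum>B \<in> orbits G (carrier G) \<phi>. card B)"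
    using act.disjoint_sum[OF fin, of "\<lambda>_. 1::nat"] by (simp add: order_def)
  also have "\<dots> = card {\<one>} + (\<Sum>B \<in> orbits G (carrier G) \<phi> - {{\<one>}}. card B)"
    by (rule sum.remove[OF finorb]) (use one in \<open>auto simp: orbits_def intro!: exI[of _ \<one>]\<close>)
  finally have "order G = 1 + (\<Sum>B \<in> orbits G (carrier G) \<phi> - {{\<one>}}. card B)" by simp
  moreover have "p dvd (\<Sum>B \<in> orbits G (carrier G) \<phi> - {{\<one>}}. card B)"
    by (rule dvd_sum) (rule div)
  moreover have "p dvd order G" using ord nt p by (cases a) auto
  ultimately have "p dvd 1" by (metis dvd_add_left_iff)
  then show False using p by simp
qed

lemma prime_power_order_proper_subgroup:
  assumes p: "Factorial_Ring.prime (p::nat)" and ord: "order G = p ^ a"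
    and "subgroup H G" "subgroup K G" "H \<subset> K"
  shows "p * card H \<le> card K"
proof -
  have fin: "finite (carrier G)" using ord p order_gt_0_iff_finite prime_gt_0_nat by simp
  have "card H dvd p ^ a" "card K dvd p ^ a"
    using lagrange assms(3,4) ord by (metis dvd_triv_right)+
  then obtain i j where ij: "card H = p ^ i" "card K = p ^ j"
    using p by (auto simp: divides_primepow_nat)
  have "card H < card K"
    using psubset_card_mono[OF _ assms(5)] finite_subset[OF subgroup.subset[OF assms(4)] fin] by blast
  then have "p ^ i < p ^ j" using ij by simp
  then have "i < j" by (rule power_less_imp_less_exp[OF prime_gt_1_nat[OF p]])
  then have "p ^ Suc i \<le> p ^ j" using prime_gt_0_nat[OF p] by (intro power_increasing) auto
  then show ?thesis using ij by simp
qed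

lemma commutator_mult_right:
  assumes "a \<in> carrier G" "g \<in> carrier G" "h \<in> carrier G"
  shows "commutator G a (g \<otimes> h) = commutator G a g \<otimes> (g \<otimes> commutator G a h \<otimes> inv g)"
  using assms by (simp add: commutator_def word_simps)

text \<open>
  Wiegold's bound for groups of prime power order, relative to a normal subgroup \<open>B\<close>: the classical statement
  is the case that \<open>B\<close> is trivial. The relative form lets the induction on \<open>n\<close> pass to quotients without leaving \<open>G\<close>.

  In the step let \<open>C/B\<close> be the center and choose \<open>x\<close> outside \<open>C\<close> that is central modulo \<open>C\<close>. Then
  \<open>g \<mapsto> [x,g]\<close> is a homomorphism from \<open>G\<close> to \<open>C/B\<close> whose kernel properly contains \<open>C\<close>, because \<open>x\<close> commutes
  with itself; so its image \<open>B1/B\<close> has order at most \<open>p^(n-1)\<close>. Modulo \<open>B1\<close> the element \<open>x\<close> becomes central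
  as well, so that the index of the center drops by a factor \<open>p\<close> at least.
\<close>

lemma prime_power_order_derived_bound:
  assumes p: "Factorial_Ring.prime (p::nat)" and ord: "order G = p ^ a"
  shows "B \<lhd> G \<Longrightarrow> order G \<le> p ^ n * card (next_center G B) \<Longrightarrow>
    \<exists>D. D \<lhd> G \<and> (\<forall>x \<in> carrier G. \<forall>y \<in> carrier G. commutator G x y \<in> D) \<and>
      card D \<le> card B * p ^ (n * (n - 1) div 2)"
proof (induction n arbitrary: B)
  have fin: "finite (carrier G)" using ord p order_gt_0_iff_finite prime_gt_0_nat by simp
  {
    case (0 B)
    have sub: "next_center G B \<subseteq> carrier G" by (auto simp: next_center_def)
    then have "next_center G B = carrier G"
      using card_seteq[OF fin sub] 0(2) by (simp add: order_def)
    then show ?case using 0(1) next_center_commutator[OF 0(1)] by (intro exI[of _ B]) auto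
  next
    case (Suc n B)
    note B = Suc.prems(1)
    interpret nB: normal B G by (rule B)
    define C where "C = next_center G B"
    have C: "C \<lhd> G" unfolding C_def by (rule next_center_normal[OF B])
    interpret nC: normal C G by (rule C)
    have Ciff: "x \<in> C \<longleftrightarrow> x \<in> carrier G \<and> (\<forall>y \<in> carrier G. commutator G x y \<in> B)" for x
      unfolding C_def by (rule next_center_commutator[OF B])
    have BC: "B \<subseteq> C" unfolding C_def by (rule next_center_superset[OF B])
    show ?case
    proof (cases "C = carrier G")
      case True
      then have "commutator G x y \<in> B" if "x \<in> carrier G" "y \<in> carrier G" for x y
        using Ciff that by blast
      moreover have "card B * 1 \<le> card B * p ^ (Suc n * (Suc n - 1) div 2)"
        using prime_gt_0_nat[OF p] by (intro mult_le_mono2 one_le_power) simp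
      ultimately show ?thesis using B by (intro exI[of _ B]) auto
    next
      case False
      interpret QC: group "G Mod C" by (rule nC.factorgroup_is_group)
      have lagC: "order (G Mod C) * card C = p ^ a"
        using lagrange[OF nC.subgroup_axioms] ord by (simp add: order_def FactGroup_def)
      then have "order (G Mod C) dvd p ^ a" by (metis dvd_triv_left)
      then obtain b where b: "order (G Mod C) = p ^ b" using p by (auto simp: divides_primepow_nat)
      have "order (G Mod C) \<noteq> 1"
        using lagC ord False card_seteq[OF fin nC.subset] by (auto simp: order_def)
      then obtain Y where Y: "Y \<in> center (G Mod C)" "Y \<noteq> C"
        using QC.prime_power_order_center_nontrivial[OF p b] by auto
      then obtain x where x: "x \<in> carrier G" "Y = C #> x"
        by (auto simp: center_def carrier_FactGroup)
      have "x \<in> next_center G C" using x Y(1) by (simp add: next_center_def)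
      then have xC: "commutator G x g \<in> C" if "g \<in> carrier G" for g
        using next_center_commutator[OF C] that by blast
      have xnC: "x \<notin> C" using Y(2) x(2) nC.rcos_const[OF is_group] by blast
      interpret QB: group "G Mod B" by (rule nB.factorgroup_is_group)
      interpret q: group_hom G "G Mod B" "\<lambda>x. B #> x" by (rule nB.coset_group_hom)
      note [simp del] = mult_FactGroup one_FactGroup
      have central: "(B #> c) \<otimes>\<^bsub>G Mod B\<^esub> (B #> g) = (B #> g) \<otimes>\<^bsub>G Mod B\<^esub> (B #> c)"
        if "c \<in> C" "g \<in> carrier G" for c g
        using commute_mod_iff[OF B, of c g] that Ciff by blast
      have conjC: "B #> (g \<otimes> c \<otimes> inv g) = B #> c" if "c \<in> C" "g \<in> carrier G" for c g
      proof -
        have "B #> (g \<otimes> c \<otimes> inv g) = (B #> g) \<otimes>\<^bsub>G Mod B\<^esub> (B #> c) \<otimes>\<^bsub>G Mod B\<^esub> inv\<^bsub>G Mod B\<^esub> (B #> g)"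
          using that by simp
        also have "\<dots> = (B #> c) \<otimes>\<^bsub>G Mod B\<^esub> (B #> g) \<otimes>\<^bsub>G Mod B\<^esub> inv\<^bsub>G Mod B\<^esub> (B #> g)"
          by (simp only: central[OF that])
        also have "\<dots> = B #> c" using that by (simp add: QB.m_assoc)
        finally show ?thesis .
      qed
      define f where "f = (\<lambda>g. B #> commutator G x g)"
      have fhom: "f \<in> hom G (G Mod B)"
      proof (rule homI)
        show "f g \<in> carrier (G Mod B)" if "g \<in> carrier G" for g using that x(1) by (simp add: f_def)
        show "f (g \<otimes> h) = f g \<otimes>\<^bsub>G Mod B\<^esub> f h" if "g \<in> carrier G" "h \<in> carrier G" for g h
        proof -
          have "f (g \<otimes> h) = (B #> commutator G x g) \<otimes>\<^bsub>G Mod B\<^esub> (B #> (g \<otimes> commutator G x h \<otimes> inv g))"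
            unfolding f_def commutator_mult_right[OF x(1) that] by (rule q.hom_mult) (use that x(1) in auto)
          then show ?thesis unfolding conjC[OF xC[OF that(2)] that(1)] f_def .
        qed
      qed
      interpret f: group_hom G "G Mod B" f
        by (intro group_hom.intro group_hom_axioms.intro is_group QB.is_group fhom)
      define B1 where "B1 = {y \<in> carrier G. B #> y \<in> f ` carrier G}"
      have B1I: "y \<in> B1" if "y \<in> carrier G" "B #> y = f g" "g \<in> carrier G" for y g
        using that unfolding B1_def by blast
      have sB1: "subgroup B1 G"
      proof (rule subgroupI)
        note fs = f.img_is_subgroup
        show "B1 \<noteq> {}" using B1I[of \<one> \<one>] f.hom_one q.hom_one by auto
        show "inv y \<in> B1" if "y \<in> B1" for y
          using that subgroup.m_inv_closed[OF fs] unfolding B1_def by simp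
        show "y \<otimes> z \<in> B1" if "y \<in> B1" "z \<in> B1" for y z
          using that subgroup.m_closed[OF fs] unfolding B1_def by simp
      qed (auto simp: B1_def)
      have B1: "B1 \<lhd> G"
      proof (rule normal_invI[OF sB1])
        fix g y assume g: "g \<in> carrier G" and "y \<in> B1"
        then obtain h where y: "y \<in> carrier G" "h \<in> carrier G" "B #> y = f h" unfolding B1_def by blast
        have "B #> (g \<otimes> y \<otimes> inv g) = B #> (g \<otimes> commutator G x h \<otimes> inv g)"
          using g y x(1) unfolding f_def by simp
        also have "\<dots> = f h" unfolding f_def by (rule conjC[OF xC[OF y(2)] g])
        finally show "g \<otimes> y \<otimes> inv g \<in> B1" by (rule B1I[rotated]) (use g y in auto)
      qed
      have BB1: "B \<subseteq> B1"
      proof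
        fix y assume y: "y \<in> B"
        then have "B #> y = f \<one>" using nB.rcos_const[OF is_group y] f.hom_one by (simp add: one_FactGroup)
        then show "y \<in> B1" using y by (intro B1I[of y \<one>]) auto
      qed
      define N where "N = kernel G (G Mod B) f"
      have Niff: "g \<in> N \<longleftrightarrow> g \<in> carrier G \<and> commutator G x g \<in> B" for g
        using coset_eq_iff[OF nB.subgroup_axioms, of "commutator G x g" \<one>] x(1) nB.subset
        by (auto simp: N_def kernel_def f_def one_FactGroup)
      have N: "subgroup N G" unfolding N_def by (rule f.subgroup_kernel)
      have "C \<subseteq> N" using Niff Ciff commutator_swap_mem[OF nB.subgroup_axioms] x(1) by blast
      moreover have "x \<in> N" using x(1) by (simp add: Niff commutator_def)
      ultimately have pN: "p * card C \<le> card N"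
        using xnC by (intro prime_power_order_proper_subgroup[OF p ord nC.subgroup_axioms N]) blast
      have cardN: "card (f ` carrier G) * card N = order G"
        unfolding N_def by (rule f.card_image_times_kernel[OF fin])
      interpret q1: group_hom "G\<lparr>carrier := B1\<rparr>" "G Mod B" "\<lambda>x. B #> x"
        by (rule q.induced_group_hom'[OF sB1])
      have "(\<lambda>x. B #> x) ` B1 = f ` carrier G"
      proof
        show "f ` carrier G \<subseteq> (\<lambda>x. B #> x) ` B1"
        proof
          fix Z assume "Z \<in> f ` carrier G"
          then obtain g where g: "g \<in> carrier G" "Z = f g" by blast
          then have "commutator G x g \<in> B1" "Z = B #> commutator G x g"
            using B1I[of "commutator G x g" g] x(1) by (simp_all add: f_def)
          then show "Z \<in> (\<lambda>x. B #> x) ` B1" by blast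
        qed
      qed (auto simp: B1_def)
      moreover have "kernel (G\<lparr>carrier := B1\<rparr>) (G Mod B) (\<lambda>x. B #> x) = B"
        using kernel_coset_map_subgroup[OF nB.subgroup_axioms sB1] BB1 by blast
      ultimately have cardB1: "card (f ` carrier G) * card B = card B1"
        using q1.card_image_times_kernel finite_subset[OF subgroup.subset[OF sB1] fin]
        by (simp add: order_def)
      have Cpos: "card C > 0" using nC.finite_imp_card_positive[OF fin] .
      have "card (f ` carrier G) * (p * card C) \<le> order G"
        using mult_le_mono2[OF pN, of "card (f ` carrier G)"] unfolding cardN .
      also have "\<dots> \<le> p ^ Suc n * card C" using Suc.prems(2) unfolding C_def .
      also have "\<dots> = p ^ n * (p * card C)" by (simp add: mult_ac)
      finally have "card (f ` carrier G) * (p * card C) \<le> p ^ n * (p * card C)" .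
      then have img: "card (f ` carrier G) \<le> p ^ n"
        using Cpos prime_gt_0_nat[OF p] by (subst (asm) mult_le_cancel2) simp
      have "C \<subseteq> next_center G B1" "x \<in> next_center G B1"
        using next_center_mono[OF B B1 BB1] next_center_commutator[OF B1] x(1)
          B1I[of "commutator G x _"] by (auto simp: C_def f_def)
      then have "p * card C \<le> card (next_center G B1)"
        using xnC
        by (intro prime_power_order_proper_subgroup[OF p ord nC.subgroup_axioms
              normal_imp_subgroup[OF next_center_normal[OF B1]]]) blast
      then have C1: "p ^ n * (p * card C) \<le> p ^ n * card (next_center G B1)" by (rule mult_le_mono2)
      have "order G \<le> p ^ Suc n * card C" using Suc.prems(2) unfolding C_def .
      also have "\<dots> = p ^ n * (p * card C)" by (simp add: mult_ac)
      finally have "order G \<le> p ^ n * card (next_center G B1)" using C1 by (rule le_trans)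
      from Suc.IH[OF B1 this] obtain D where D: "D \<lhd> G"
        "\<forall>x \<in> carrier G. \<forall>y \<in> carrier G. commutator G x y \<in> D"
        "card D \<le> card B1 * p ^ (n * (n - 1) div 2)" by blast
      note D(3)
      also have "card B1 * p ^ (n * (n - 1) div 2) \<le> (p ^ n * card B) * p ^ (n * (n - 1) div 2)"
        using img cardB1 by (metis mult_le_mono1)
      also have "\<dots> = card B * p ^ (n + n * (n - 1) div 2)" by (simp add: power_add)
      also have "n + n * (n - 1) div 2 = Suc n * (Suc n - 1) div 2"
        by (cases n) (simp_all add: algebra_simps)
      finally show ?thesis using D(1,2) by blast
    qed
  }
qed

section \<open>Central subgroups inside the derived subgroup\<close>

text \<open>
  Let \<open>L\<close> be the stable term and \<open>L'\<close> its derived subgroup. The section \<open>L/L'\<close> is perfect under \<open>G\<close> and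
  \<open>L\<close> itself acts trivially on it, so it has no nontrivial fixed points. Hence \<open>K\<close> is swallowed by \<open>L'\<close>
  stage by stage: once the part of \<open>K\<close> in stage \<open>n\<close> lies in \<open>L'\<close>, the part in stage \<open>n + 1\<close> is fixed by \<open>G\<close>
  modulo \<open>L'\<close>.
\<close>

lemma stable_lower_central_Int_upper_central:
  assumes fin: "finite (lower_central G m)" and stable: "lower_central G m \<subseteq> lower_central G (Suc m)"
    and K: "K \<subseteq> lower_central G m" "K \<subseteq> (\<Union>n. nat_upper_central G n)"
      "\<And>k g. k \<in> K \<Longrightarrow> g \<in> carrier G \<Longrightarrow> commutator G k g \<in> K"
  shows "K \<subseteq> generate G {commutator G a b | a b. a \<in> lower_central G m \<and> b \<in> lower_central G m}"
proof -
  define L where "L = lower_central G m"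
  have L: "L \<lhd> G" unfolding L_def by (rule lower_central_normal)
  interpret nL: normal L G by (rule L)
  define S where "S = {commutator G a b | a b. a \<in> L \<and> b \<in> L}"
  define B where "B = generate G S"
  have SL: "S \<subseteq> L" using commutator_in_normal[OF L] by (auto simp: S_def)
  have BL: "B \<subseteq> L" unfolding B_def by (rule generate_subgroup_incl[OF SL nL.subgroup_axioms])
  have B: "B \<lhd> G"
    unfolding B_def
  proof (rule normal_generateI)
    show "S \<subseteq> carrier G" using SL nL.subset by blast
    fix h g assume h: "h \<in> S" and g: "g \<in> carrier G"
    then obtain a b where ab: "h = commutator G a b" "a \<in> L" "b \<in> L" by (auto simp: S_def)
    then have "g \<otimes> h \<otimes> inv g = commutator G (g \<otimes> a \<otimes> inv g) (g \<otimes> b \<otimes> inv g)"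
      using g by (simp add: commutator_conj)
    moreover have "g \<otimes> a \<otimes> inv g \<in> L" "g \<otimes> b \<otimes> inv g \<in> L" using nL.inv_op_closed2 g ab by simp_all
    ultimately show "g \<otimes> h \<otimes> inv g \<in> S" unfolding S_def by blast
  qed
  have com: "commutator G a b \<in> B" if "a \<in> L" "b \<in> L" for a b
    unfolding B_def by (rule generate.incl) (use that in \<open>auto simp: S_def\<close>)
  have "L \<subseteq> generate G ({commutator G a g | a g. a \<in> L \<and> g \<in> carrier G} \<union> B)"
    using stable mono_generate[of "{commutator G a g | a g. a \<in> L \<and> g \<in> carrier G}"
        "{commutator G a g | a g. a \<in> L \<and> g \<in> carrier G} \<union> B"]
    by (simp add: L_def)
  from trivial_fixed_points_of_perfect_section[OF L B BL _ com this, of m]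
  have fixed: "x \<in> B" if "x \<in> L" "\<And>g. g \<in> carrier G \<Longrightarrow> commutator G x g \<in> B" for x
    using that fin com unfolding L_def by blast
  have "K \<inter> nat_upper_central G n \<subseteq> B" for n
  proof (induction n)
    case 0
    then show ?case using normal_imp_subgroup[OF B] by (auto simp: subgroup.one_closed)
  next
    case (Suc n)
    show ?case
    proof
      fix x assume x: "x \<in> K \<inter> nat_upper_central G (Suc n)"
      show "x \<in> B"
      proof (rule fixed)
        show "x \<in> L" using x K(1) by (auto simp: L_def)
        fix g assume g: "g \<in> carrier G"
        have "commutator G x g \<in> nat_upper_central G n"
          using x g nat_upper_central_Suc_iff[of x n] by blast
        then show "commutator G x g \<in> B" using Suc K(3)[OF _ g] x by blast
      qed
    qed
  qed
  then have "K \<subseteq> B" using K(2) by blast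
  then show ?thesis by (simp add: B_def S_def L_def)
qed

text \<open>
  Let \<open>P\<close> be a Sylow \<open>q\<close>-subgroup and \<open>D\<close> a small normal subgroup of \<open>P\<close> with abelian quotient. The transfer
  from \<open>G\<close> to \<open>P/D\<close> is trivial on commutators, hence on \<open>K\<close>, but on the central subgroup \<open>P \<inter> K\<close> it raises
  to the power \<open>[G:P]\<close>, which is prime to \<open>q\<close>. So \<open>P \<inter> K\<close> lies in \<open>D\<close>. On the other hand \<open>P \<inter> K\<close> has index
  at most \<open>q^n\<close> in \<open>P\<close>, where \<open>q^n\<close> is the \<open>q\<close>-part of \<open>s\<close>; this bounds \<open>D\<close>, and it shows that \<open>P \<inter> K\<close>
  accounts for the whole \<open>q\<close>-part of \<open>K\<close>.
\<close>

lemma multiplicity_central_derived_bound: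
  assumes fin: "finite (carrier G)" and q: "Factorial_Ring.prime (q::nat)"
    and K: "subgroup K G" and central: "\<And>k g. k \<in> K \<Longrightarrow> g \<in> carrier G \<Longrightarrow> k \<otimes> g = g \<otimes> k"
    and der: "K \<subseteq> generate G {commutator G a b | a b. a \<in> carrier G \<and> b \<in> carrier G}"
    and ord: "order G = card K * s"
  shows "multiplicity q (card K) \<le> multiplicity q s * (multiplicity q s - 1) div 2"
proof -
  interpret sK: subgroup K G by (rule K)
  define n where "n = multiplicity q s"
  define a where "a = multiplicity q (order G)"
  have pos: "order G > 0" using fin by (simp add: order_gt_0_iff_finite)
  then have nz: "card K \<noteq> 0" "s \<noteq> 0" using ord by auto
  have a: "a = multiplicity q (card K) + n"
    unfolding a_def n_def ord using q nz by (simp add: prime_elem_multiplicity_mult_distrib)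
  have "order G \<noteq> 0" "\<not> is_unit q" using pos prime_gt_1_nat[OF q] by simp_all
  then obtain m where m: "order G = q ^ a * m" "\<not> q dvd m"
    unfolding a_def by (rule multiplicity_decompose')
  obtain P where P: "subgroup P G" "card P = q ^ a"
    using sylow_thm[OF q is_group m(1) fin] by blast
  interpret sP: subgroup P G by (rule P(1))
  interpret GP: group "G\<lparr>carrier := P\<rparr>" by (rule subgroup_imp_group[OF P(1)])
  have finP: "finite P" using finite_subset[OF sP.subset fin] .
  have ordP: "order (G\<lparr>carrier := P\<rparr>) = q ^ a" using P(2) by (simp add: order_def)

  have nK: "K \<lhd> G"
  proof (rule normal_invI[OF K])
    fix x h assume xh: "x \<in> carrier G" "h \<in> K"
    have "x \<otimes> h \<otimes> inv x = h \<otimes> x \<otimes> inv x" using central[OF xh(2,1)] by simp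
    then show "x \<otimes> h \<otimes> inv x \<in> K" using xh by (simp add: m_assoc)
  qed
  interpret nK: normal K G by (rule nK)
  interpret QK: group "G Mod K" by (rule nK.factorgroup_is_group)
  interpret k: group_hom G "G Mod K" "\<lambda>x. K #> x" by (rule nK.coset_group_hom)
  interpret kP: group_hom "G\<lparr>carrier := P\<rparr>" "G Mod K" "\<lambda>x. K #> x"
    by (rule k.induced_group_hom'[OF P(1)])
  note ker = kernel_coset_map_subgroup[OF K P(1)]
  define i where "i = card ((\<lambda>x. K #> x) ` P)"
  have iP: "i * card (P \<inter> K) = q ^ a"
    using kP.card_image_times_kernel finP P(2) by (simp add: ker i_def order_def)
  have "order (G Mod K) * card K = card K * s"
    using lagrange[OF K] ord by (simp add: order_def FactGroup_def)
  then have "order (G Mod K) = s" using nz by simp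
  moreover have "subgroup ((\<lambda>x. K #> x) ` P) (G Mod K)" using k.subgroup_img_is_subgroup[OF P(1)] .
  ultimately have "i dvd s" unfolding i_def using QK.lagrange by (metis dvd_triv_right)
  have "i dvd q ^ a" "card (P \<inter> K) dvd q ^ a" using iP by (metis dvd_triv_left, metis dvd_triv_right)
  then obtain j l where j: "i = q ^ j" and l: "card (P \<inter> K) = q ^ l"
    using q by (auto simp: divides_primepow_nat)
  have "j \<le> n" unfolding n_def using \<open>i dvd s\<close> j nz(2) q
    by (intro multiplicity_geI) (auto dest: prime_gt_1_nat)
  have "q ^ (j + l) = q ^ a" using iP j l by (simp add: power_add)
  then have jl: "j + l = a" using power_inject_exp[OF prime_gt_1_nat[OF q]] by blast

  have one: "{\<one>} \<lhd> G\<lparr>carrier := P\<rparr>" using GP.one_is_normal by simp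
  have "P \<inter> K \<subseteq> next_center (G\<lparr>carrier := P\<rparr>) {\<one>}"
  proof
    fix x assume x: "x \<in> P \<inter> K"
    have "commutator (G\<lparr>carrier := P\<rparr>) x y = \<one>" if "y \<in> P" for y
    proof -
      have "commutator G x y = \<one>" using commutator_eq_one_iff[of x y] central[of x y] x that by auto
      then show ?thesis using commutator_subgroup[OF P(1), of x y] x that by simp
    qed
    then show "x \<in> next_center (G\<lparr>carrier := P\<rparr>) {\<one>}"
      using GP.next_center_commutator[OF one] x by simp
  qed
  moreover have "finite (next_center (G\<lparr>carrier := P\<rparr>) {\<one>})"
    using finP by (auto simp: next_center_def)
  ultimately have "q ^ l \<le> card (next_center (G\<lparr>carrier := P\<rparr>) {\<one>})" using card_mono l by metis
  then have "q ^ j * q ^ l \<le> q ^ n * card (next_center (G\<lparr>carrier := P\<rparr>) {\<one>})"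
    using \<open>j \<le> n\<close> prime_gt_0_nat[OF q] by (intro mult_le_mono power_increasing) auto
  then have "order (G\<lparr>carrier := P\<rparr>) \<le> q ^ n * card (next_center (G\<lparr>carrier := P\<rparr>) {\<one>})"
    using ordP jl by (simp flip: power_add)
  from GP.prime_power_order_derived_bound[OF q ordP one this]
  obtain D where D: "D \<lhd> G\<lparr>carrier := P\<rparr>" "card D \<le> q ^ (n * (n - 1) div 2)"
    and Dcom: "\<And>x y. x \<in> P \<Longrightarrow> y \<in> P \<Longrightarrow> commutator (G\<lparr>carrier := P\<rparr>) x y \<in> D"
    by auto

  interpret nD: normal D "G\<lparr>carrier := P\<rparr>" by (rule D(1))
  define T where "T = G\<lparr>carrier := P\<rparr> Mod D"
  have gT: "group T" unfolding T_def by (rule nD.factorgroup_is_group)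
  interpret T: comm_group T
  proof (rule group.group_comm_groupI[OF gT])
    fix x y assume "x \<in> carrier T" "y \<in> carrier T"
    then obtain u v where uv: "u \<in> P" "v \<in> P" "x = D #>\<^bsub>G\<lparr>carrier := P\<rparr>\<^esub> u" "y = D #>\<^bsub>G\<lparr>carrier := P\<rparr>\<^esub> v"
      unfolding T_def carrier_FactGroup by auto
    then show "x \<otimes>\<^bsub>T\<^esub> y = y \<otimes>\<^bsub>T\<^esub> x"
      using GP.commute_mod_iff[OF D(1), of u v] Dcom[OF uv(1,2)] unfolding T_def uv(3,4) by simp
  qed
  define \<phi> where "\<phi> = (\<lambda>x. D #>\<^bsub>G\<lparr>carrier := P\<rparr>\<^esub> x)"
  interpret phi: group_hom "G\<lparr>carrier := P\<rparr>" T \<phi>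
    unfolding T_def \<phi>_def by (rule nD.coset_group_hom)
  have finR: "finite (rcosets P)"
    by (rule finite_subset[OF rcosets_subset_PowG[OF P(1)]]) (use fin in simp)
  define e where "e = card (rcosets P)"
  have "e * q ^ a = q ^ a * m" using lagrange[OF P(1)] m(1) P(2) by (simp add: e_def)
  then have "e = m" using prime_gt_0_nat[OF q] by simp
  have "\<exists>V. V \<in> hom G T \<and> (\<forall>z \<in> P \<inter> K. V z = \<phi> z [^]\<^bsub>T\<^esub> e)"
  proof (rule transfer_hom[OF T.comm_group_axioms P(1) finR phi.homh])
    fix V assume "V \<in> hom G T" "\<And>z. z \<in> P \<Longrightarrow> (\<And>g. g \<in> carrier G \<Longrightarrow> z \<otimes> g = g \<otimes> z) \<Longrightarrow>
      V z = \<phi> z [^]\<^bsub>T\<^esub> card (rcosets P)"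
    then show ?thesis using central unfolding e_def by blast
  qed
  then obtain V where V: "V \<in> hom G T" "\<And>z. z \<in> P \<inter> K \<Longrightarrow> V z = \<phi> z [^]\<^bsub>T\<^esub> e" by blast
  interpret V: group_hom G T V
    by (intro group_hom.intro group_hom_axioms.intro is_group T.is_group V(1))
  have "generate G {commutator G a b | a b. a \<in> carrier G \<and> b \<in> carrier G} \<subseteq> kernel G T V"
  proof (rule generate_subgroup_incl[OF _ V.subgroup_kernel])
    have "V (commutator G a b) = \<one>\<^bsub>T\<^esub>" if "a \<in> carrier G" "b \<in> carrier G" for a b
      using that T.commutator_eq_one_iff[of "V a" "V b"] T.m_comm by (simp add: V.hom_commutator)
    then show "{commutator G a b |a b. a \<in> carrier G \<and> b \<in> carrier G} \<subseteq> kernel G T V"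
      by (auto simp: kernel_def)
  qed
  then have VK: "V z = \<one>\<^bsub>T\<^esub>" if "z \<in> K" for z using der that by (auto simp: kernel_def)
  have "z \<in> D" if z: "z \<in> P \<inter> K" for z
  proof -
    have zT: "\<phi> z \<in> carrier T" using phi.hom_closed[of z] z by simp
    have "\<phi> z [^]\<^bsub>T\<^esub> e = \<one>\<^bsub>T\<^esub>" using V(2)[OF z] VK z by simp
    then have "T.ord (\<phi> z) dvd m" using T.pow_eq_id[OF zT] \<open>e = m\<close> by simp
    moreover have "\<phi> z [^]\<^bsub>T\<^esub> (q ^ a) = \<one>\<^bsub>T\<^esub>"
    proof -
      have "z [^]\<^bsub>G\<lparr>carrier := P\<rparr>\<^esub> (q ^ a) = \<one>"
        using GP.pow_order_eq_1[of z] z ordP by simp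
      then show ?thesis using phi.hom_nat_pow[of z "q ^ a"] phi.hom_one z by simp
    qed
    then have "T.ord (\<phi> z) dvd q ^ a" using T.pow_eq_id[OF zT] by simp
    moreover have "coprime (q ^ a) m" using m(2) q by (simp add: prime_imp_coprime)
    ultimately have "T.ord (\<phi> z) = 1" by (metis coprime_common_divisor_nat coprime_commute)
    then have "\<phi> z = \<one>\<^bsub>T\<^esub>" using T.ord_eq_1[OF zT] by simp
    then have "D #>\<^bsub>G\<lparr>carrier := P\<rparr>\<^esub> z = D #>\<^bsub>G\<lparr>carrier := P\<rparr>\<^esub> \<one>"
      using GP.coset_mult_one[OF nD.subset] unfolding \<phi>_def T_def by simp
    then show ?thesis
      using GP.coset_eq_iff[OF nD.subgroup_axioms, of z \<one>] z P(1) by simp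
  qed
  then have "P \<inter> K \<subseteq> D" by blast
  moreover have "finite D" using finite_subset[OF nD.subset] finP by simp
  ultimately have "q ^ l \<le> q ^ (n * (n - 1) div 2)" using card_mono D(2) l by (metis le_trans)
  then have "l \<le> n * (n - 1) div 2" using power_le_imp_le_exp[OF prime_gt_1_nat[OF q]] by blast
  then show ?thesis using a jl \<open>j \<le> n\<close> unfolding n_def by linarith
qed

end

section \<open>The bound\<close>

text \<open>
  If \<open>q^n\<close> is the \<open>q\<close>-part of \<open>s\<close>, then the \<open>q\<close>-part of \<open>c s\<close> is at most \<open>q^(n(n+1)/2) = (q^n)^((n+1)/2)\<close>,
  and \<open>p^n \<le> q^n \<le> t\<close> gives \<open>n \<le> log p t\<close>. The product over all \<open>q\<close> is at most \<open>s powr e\<close> with the exponent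
  \<open>e\<close> of the conclusion.
\<close>

lemma mult_le_powr_of_multiplicity_bound:
  fixes c s t p :: nat
  assumes c: "c > 0" and t: "t > 0" and s: "s dvd t"
    and p: "p > 1" and least: "\<And>q. Factorial_Ring.prime q \<Longrightarrow> q dvd t \<Longrightarrow> p \<le> q"
    and bound: "\<And>q. Factorial_Ring.prime q \<Longrightarrow>
      multiplicity q c \<le> multiplicity q s * (multiplicity q s - 1) div 2"
  shows "real (c * s) \<le> real t powr (1 / 2 * (log (real p) (real t) + 1))"
proof -
  define e where "e = 1 / 2 * (log (real p) (real t) + 1)"
  have s0: "s > 0" "s \<le> t" using s t by (auto intro: Nat.gr0I dvd_imp_le)
  have e0: "e \<ge> 0" unfolding e_def using p t by (simp add: zero_le_log_cancel_iff)
  define F where "F = prime_factors s"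
  have "prime_factors c \<subseteq> F"
  proof
    fix q assume q: "q \<in> prime_factors c"
    then have pq: "Factorial_Ring.prime q" "multiplicity q c > 0"
      using c by (auto simp: prime_factors_multiplicity)
    then have "multiplicity q s > 0" using bound[OF pq(1)] by (cases "multiplicity q s") auto
    then show "q \<in> F" using pq(1) by (auto simp: F_def prime_factors_multiplicity)
  qed
  moreover have "q ^ multiplicity q c = 1" if "q \<in> F - prime_factors c" for q
    using that by (auto simp: F_def prime_factors_multiplicity)
  ultimately have "(\<Prod>q \<in> F. q ^ multiplicity q c) = (\<Prod>q \<in> prime_factors c. q ^ multiplicity q c)"
    by (intro prod.mono_neutral_right) (auto simp: F_def)
  also have "\<dots> = c" using prime_factorization_nat[OF c] by simp
  finally have c_prod: "c = (\<Prod>q \<in> F. q ^ multiplicity q c)" ..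
  have s_prod: "s = (\<Prod>q \<in> F. q ^ multiplicity q s)"
    unfolding F_def by (rule prime_factorization_nat[OF s0(1)])
  have factor: "real (q ^ multiplicity q c * q ^ multiplicity q s) \<le> real (q ^ multiplicity q s) powr e"
    if q: "q \<in> F" for q
  proof -
    define n where "n = multiplicity q s"
    have pq: "Factorial_Ring.prime q" "q dvd s" using q s0 by (auto simp: F_def prime_factors_dvd)
    have q1: "q > 1" using prime_gt_1_nat[OF pq(1)] .
    have "p \<le> q" using least[OF pq(1)] pq(2) s dvd_trans by blast
    have "p ^ n \<le> q ^ n" using \<open>p \<le> q\<close> by (simp add: power_mono)
    also have "q ^ n \<le> s" unfolding n_def by (rule dvd_imp_le[OF multiplicity_dvd s0(1)])
    finally have "real p powr real n \<le> real t"
      using s0(2) p by (simp add: powr_realpow flip: of_nat_power)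
    then have n_le: "real n \<le> log (real p) (real t)" using p t by (simp add: le_log_iff)
    have "2 * (multiplicity q c + n) \<le> n * (n - 1) + 2 * n"
      using bound[OF pq(1)] by (simp add: n_def)
    also have "n * (n - 1) + 2 * n = n * (n + 1)" by (cases n) (simp_all add: algebra_simps)
    finally have "real (2 * (multiplicity q c + n)) \<le> real (n * (n + 1))" by (rule of_nat_mono)
    then have "real (multiplicity q c + n) \<le> real n * (1 / 2 * (real n + 1))" by (simp add: algebra_simps)
    also have "\<dots> \<le> real n * e" unfolding e_def using n_le by (intro mult_left_mono) auto
    finally have ex: "real (multiplicity q c + n) \<le> real n * e" .
    have "real (q ^ multiplicity q c * q ^ n) = real q powr real (multiplicity q c + n)"
      using q1 by (simp add: powr_realpow powr_add)
    also have "\<dots> \<le> real q powr (real n * e)" using ex q1 by (intro powr_mono) auto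
    also have "\<dots> = real (q ^ n) powr e" using q1 by (simp add: powr_realpow flip: powr_powr)
    finally show ?thesis by (simp add: n_def)
  qed
  have "real (c * s) = (\<Prod>q \<in> F. real (q ^ multiplicity q c * q ^ multiplicity q s))"
    by (simp only: of_nat_prod[symmetric] prod.distrib c_prod[symmetric] s_prod[symmetric])
  also have "\<dots> \<le> (\<Prod>q \<in> F. real (q ^ multiplicity q s) powr e)"
    by (rule prod_mono) (use factor in auto)
  also have "\<dots> = (\<Prod>q \<in> F. real (q ^ multiplicity q s)) powr e"
    by (rule prod_powr_distrib[symmetric])
  also have "(\<Prod>q \<in> F. real (q ^ multiplicity q s)) = real s"
    by (simp only: of_nat_prod[symmetric] s_prod[symmetric])
  also have "real s powr e \<le> real t powr e" using s0 e0 by (intro powr_mono2) auto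
  finally show ?thesis by (simp add: e_def)
qed

theorem theoremB:
  fixes G :: "('a, 'm) monoid_scheme" and t p :: nat
  assumes "group G"
    and "finite (carrier (G Mod upper_hypercenter G))"
    and "t = order (G Mod upper_hypercenter G)"
    and "p = (LEAST q. Factorial_Ring.prime q \<and> q dvd t)"
  shows "\<exists>L. L \<lhd> G \<and> finite L \<and> hypercentral (G Mod L) \<and>
    real (card L) \<le> (if t = 1 then 1 else real t powr (1 / 2 * (log (real p) (real t) + 1)))"
proof -
  interpret group G by (rule assms(1))
  define Z where "Z = upper_hypercenter G"
  have Z: "Z \<lhd> G" unfolding Z_def by (rule upper_hypercenter_is_last_term(2)[OF is_group])
  interpret nZ: normal Z G by (rule Z)
  obtain U m where U: "subgroup U G"
    and ZU: "Z \<inter> U \<subseteq> (\<Union>n. nat_upper_central (G\<lparr>carrier := U\<rparr>) n)"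
    and fin: "finite (lower_central (G\<lparr>carrier := U\<rparr>) m)"
    and stable: "\<And>k. lower_central (G\<lparr>carrier := U\<rparr>) m \<subseteq> lower_central (G\<lparr>carrier := U\<rparr>) k"
    and nL: "lower_central (G\<lparr>carrier := U\<rparr>) m \<lhd> G"
    and central: "\<And>z x. z \<in> Z \<Longrightarrow> x \<in> lower_central (G\<lparr>carrier := U\<rparr>) m \<Longrightarrow> x \<otimes>\<^bsub>G\<^esub> z = z \<otimes>\<^bsub>G\<^esub> x"
    and hyper: "hypercentral (G Mod lower_central (G\<lparr>carrier := U\<rparr>) m)"
    using finite_residual_exists[OF assms(2)] unfolding Z_def by metis
  define L where "L = lower_central (G\<lparr>carrier := U\<rparr>) m"
  note fin = fin[folded L_def] and nL = nL[folded L_def] and central = central[folded L_def]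
    and hyper = hyper[folded L_def]
  interpret U: group "G\<lparr>carrier := U\<rparr>" by (rule subgroup_imp_group[OF U])
  interpret nL: normal L G by (rule nL)
  interpret GL: group "G\<lparr>carrier := L\<rparr>" by (rule subgroup_imp_group[OF nL.subgroup_axioms])
  have LU: "L \<subseteq> U" using U.lower_central_carrier by (auto simp: L_def)
  \<comment> \<open>\<open>K\<close> is central in \<open>L\<close>, and \<open>L/K\<close> embeds in \<open>G/Z\<close>, so that its order \<open>s\<close> divides \<open>t\<close>.\<close>
  define K where "K = L \<inter> Z"
  have KL: "K \<subseteq> L" by (simp add: K_def)
  have K: "subgroup K (G\<lparr>carrier := L\<rparr>)"
    unfolding K_def using subgroup_incl[OF subgroups_Inter_pair[OF nL.subgroup_axioms nZ.subgroup_axioms]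
        nL.subgroup_axioms] by simp

  interpret QZ: group "G Mod Z" by (rule nZ.factorgroup_is_group)
  interpret q: group_hom G "G Mod Z" "\<lambda>x. Z #>\<^bsub>G\<^esub> x" by (rule nZ.coset_group_hom)
  interpret qL: group_hom "G\<lparr>carrier := L\<rparr>" "G Mod Z" "\<lambda>x. Z #>\<^bsub>G\<^esub> x"
    by (rule q.induced_group_hom'[OF nL.subgroup_axioms])
  have ker: "kernel (G\<lparr>carrier := L\<rparr>) (G Mod Z) (\<lambda>x. Z #>\<^bsub>G\<^esub> x) = K"
    unfolding K_def by (rule kernel_coset_map_subgroup[OF nZ.subgroup_axioms nL.subgroup_axioms])
  define s where "s = card ((\<lambda>x. Z #>\<^bsub>G\<^esub> x) ` L)"
  have ordL: "order (G\<lparr>carrier := L\<rparr>) = card K * s"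
    using qL.card_image_times_kernel fin by (simp add: ker s_def mult.commute)
  have "s dvd t"
    using QZ.lagrange[OF q.subgroup_img_is_subgroup[OF nL.subgroup_axioms]]
    unfolding s_def assms(3) Z_def[symmetric] by (metis dvd_triv_right)
  have t0: "t > 0" using QZ.order_gt_0_iff_finite assms(2,3) by (simp add: Z_def)
  have K0: "card K > 0" using subgroup.finite_imp_card_positive[OF K] fin by simp

  have "K \<subseteq> generate (G\<lparr>carrier := U\<rparr>)
      {commutator (G\<lparr>carrier := U\<rparr>) a b | a b. a \<in> L \<and> b \<in> L}"
    unfolding L_def
  proof (rule U.stable_lower_central_Int_upper_central)
    show "finite (lower_central (G\<lparr>carrier := U\<rparr>) m)" using fin by (simp add: L_def)
    show "K \<subseteq> (\<Union>n. nat_upper_central (G\<lparr>carrier := U\<rparr>) n)" using ZU LU by (auto simp: K_def)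
    show "commutator (G\<lparr>carrier := U\<rparr>) k g \<in> K" if "k \<in> K" "g \<in> carrier (G\<lparr>carrier := U\<rparr>)" for k g
    proof -
      have kg: "k \<in> L" "k \<in> Z" "g \<in> U" "g \<in> carrier G" "k \<in> carrier G"
        using that subgroup.mem_carrier[OF U] by (auto simp: K_def)
      have "commutator G k g \<in> L \<inter> Z"
        using commutator_in_normal[OF nL] commutator_in_normal[OF Z] kg by blast
      then show ?thesis using commutator_subgroup[OF U] kg LU by (auto simp: K_def)
    qed
  qed (use KL stable in \<open>auto simp: L_def simp del: lower_central.simps\<close>)
  also have "{commutator (G\<lparr>carrier := U\<rparr>) a b | a b. a \<in> L \<and> b \<in> L} =
      {commutator G a b | a b. a \<in> L \<and> b \<in> L}"
    using commutator_subgroup[OF U subsetD[OF LU] subsetD[OF LU]] by (intro Collect_cong iff_exI) auto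
  also have "\<dots> = {commutator (G\<lparr>carrier := L\<rparr>) a b | a b. a \<in> L \<and> b \<in> L}" (is "?S = ?S'")
    using commutator_subgroup[OF nL.subgroup_axioms] by (intro Collect_cong iff_exI) auto
  also have "generate (G\<lparr>carrier := U\<rparr>) ?S' = generate (G\<lparr>carrier := L\<rparr>) ?S'"
  proof -
    have "?S' \<subseteq> L" using GL.commutator_closed by auto
    then show ?thesis
      using generate_consistent[OF _ nL.subgroup_axioms] generate_consistent[OF _ U] LU by auto
  qed
  finally have der: "K \<subseteq> generate (G\<lparr>carrier := L\<rparr>) ?S'" .

  have bound: "multiplicity q (card K) \<le> multiplicity q s * (multiplicity q s - 1) div 2"
    if "Factorial_Ring.prime q" for q
  proof (rule GL.multiplicity_central_derived_bound[OF _ that K _ _ ordL])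
    show "finite (carrier (G\<lparr>carrier := L\<rparr>))" using fin by simp
    show "k \<otimes>\<^bsub>G\<lparr>carrier := L\<rparr>\<^esub> g = g \<otimes>\<^bsub>G\<lparr>carrier := L\<rparr>\<^esub> k"
      if "k \<in> K" "g \<in> carrier (G\<lparr>carrier := L\<rparr>)" for k g
      using that central[of k g] by (simp add: K_def)
  qed (use der in simp)
  have cL: "card L = card K * s" using ordL by (simp add: order_def)
  have "real (card L) \<le> (if t = 1 then 1 else real t powr (1 / 2 * (log (real p) (real t) + 1)))"
  proof (cases "t = 1")
    case True
    \<comment> \<open>Any base above \<open>1\<close> serves, since \<open>1 powr a = 1\<close> for every exponent.\<close>
    have "real (card K * s) \<le> real t powr (1 / 2 * (log (real 2) (real t) + 1))"
      by (rule mult_le_powr_of_multiplicity_bound[OF K0 t0 \<open>s dvd t\<close> _ _ bound])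
        (use True in auto)
    then show ?thesis using True cL by simp
  next
    case False
    have "\<exists>q. Factorial_Ring.prime q \<and> q dvd t" using prime_factor_nat[OF False] by blast
    then have p: "Factorial_Ring.prime p \<and> p dvd t" unfolding assms(4) by (rule LeastI_ex)
    have "p \<le> q" if "Factorial_Ring.prime q" "q dvd t" for q
      unfolding assms(4) by (rule Least_le) (use that in blast)
    then have "real (card K * s) \<le> real t powr (1 / 2 * (log (real p) (real t) + 1))"
      using p by (intro mult_le_powr_of_multiplicity_bound[OF K0 t0 \<open>s dvd t\<close> _ _ bound])
        (auto dest: prime_gt_1_nat)
    then show ?thesis using False cL by simp
  qed
  then show ?thesis using nL fin hyper by blast
qed

end
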